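(* There exists a double series $$\sum_{n,k=1}^\infty c_{n,k}W_n(x)W_k(y)\quad\text{with real coefficients satisfying}\quad \sum_{n,k=1}^\infty |c_{n,k}|^q<\infty\ \text{ for all } q>2,$$ with the following property: for every number $\varepsilon>0$ there exists a measurable function $\mu(x,y)$ on $T=[0,1]^2$ satisfying $$0<\mu(x,y)\le 1,\qquad \left|\{(x,y)\in T:\mu(x,y)\neq 1\}\right|<\varepsilon,$$ such that the series is universal in $L^1_\mu(T)$ concerning subseries with respect to convergence in the sense of both spherical and rectangular partial sums.
   Context: $|A|$ denotes the Lebesgue measure of $A$. Walsh–Paley system: let $r_0$ be the $1$-periodic function equal to $1$ on $[0,1/2)$ and $-1$ on $[1/2,1)$, and $r_k(x)=r_0(2^kx)$ for $k\ge 1$. Put $W_0=1$, and for $n=\sum_{s=1}^k 2^{m_s}$ with $m_1>m_2>\dots>m_k\ge 0$ put $W_n(x)=\prod_{s=1}^k r_{m_s}(x)$. For a measurable weight $\mu$ on $T=[0,1]^2$ with $0<\mu\le 1$, $L^1_\mu(T)$ is the space of real measurable functions $f$ on $T$ with $\iint_T|f(x,y)|\mu(x,y)\,dx\,dy<\infty$. For a double series $\sum_{k,\nu=1}^\infty c_{k,\nu}W_k(x)W_\nu(y)$ the rectangular partial sums are $S_{n,m}(x,y)=\sum_{k=1}^n\sum_{\nu=1}^m c_{k,\nu}W_k(x)W_\nu(y)$ and the spherical partial sums are $S_R(x,y)=\sum_{k^2+\nu^2\le R^2}c_{k,\nu}W_k(x)W_\nu(y)$. A subseries of the double series is a double series $\sum_{k,\nu=1}^\infty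 \delta_{k,\nu}c_{k,\nu}W_k(x)W_\nu(y)$ with all $\delta_{k,\nu}\in\{0,1\}$ (the terms not selected are replaced by $0$). The double series is universal in $L^1_\mu(T)$ concerning subseries with respect to convergence in the sense of both spherical and rectangular partial sums if for every $f\in L^1_\mu(T)$ there is a subseries whose rectangular partial sums $S_{n,m}$ and spherical partial sums $S_R$ satisfy $\iint_T|S_{n,m}-f|\mu\,dx\,dy\to 0$ as $\min\{n,m\}\to\infty$ and $\iint_T|S_R-f|\mu\,dx\,dy\to 0$ as $R\to\infty$. *)

theory Defs
  imports "HOL-Analysis.Analysis"
begin

definition rademacher :: "nat \<Rightarrow> real \<Rightarrow> real" where
  "rademacher k x = (if frac (2 ^ k * x) < 1 / 2 then 1 else -1)"

text \<open>In Paley's ordering, the factors of the \<open>n\<close>-th Walsh function are the Rademacher functions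
  whose indices are the positions of the digit \<open>1\<close> in the binary expansion of \<open>n\<close>.\<close>

definition walsh :: "nat \<Rightarrow> real \<Rightarrow> real" where
  "walsh n x = (\<Prod>m | bit n m. rademacher m x)"

lemma bit_sum_power_two:
  assumes "finite S"
  shows "bit (\<Sum>m\<in>S. 2 ^ m :: nat) i \<longleftrightarrow> i \<in> S"
  using assms
proof (induction S arbitrary: i)
  case (insert m S)
  have "(\<Sum>m\<in>insert m S. 2 ^ m :: nat) = or (2 ^ m) (\<Sum>m\<in>S. 2 ^ m)"
    using insert by (subst disjunctive_add_eq_or [symmetric])
      (auto intro!: bit_eqI simp: bit_and_iff bit_exp_iff)
  then show ?case
    using insert by (auto simp: bit_or_iff bit_exp_iff)
qed simp

lemma walsh_sum_power_two:
  "finite S \<Longrightarrow> walsh (\<Sum>m\<in>S. 2 ^ m) x = (\<Prod>m\<in>S. rademacher m x)"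
  by (simp add: walsh_def bit_sum_power_two)

definition unit_square :: "(real \<times> real) set" where
  "unit_square = {0..1} \<times> {0..1}"

text \<open>Functions on the unit square are modelled by total functions on the plane, of which only the
  values on the square matter. Measurability is in the sense of Lebesgue. The integral of the
  nonnegative function \<open>\<bar>f\<bar> \<mu>\<close> is taken in \<open>[0, \<infinity>]\<close>, so that no junk value arises if it diverges.\<close>

definition weighted_norm :: "(real \<times> real \<Rightarrow> real) \<Rightarrow> (real \<times> real \<Rightarrow> real) \<Rightarrow> ennreal" where
  "weighted_norm \<mu> f = (\<integral>\<^sup>+ p. ennreal (\<bar>f p\<bar> * \<mu> p) \<partial>lebesgue_on unit_square)"

definition weighted_L1 :: "(real \<times> real \<Rightarrow> real) \<Rightarrow> (real \<times> real \<Rightarrow> real) set" where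
  "weighted_L1 \<mu> = {f \<in> borel_measurable (lebesgue_on unit_square). weighted_norm \<mu> f < \<infinity>}"

text \<open>A double series \<open>\<Sum>\<^sub>k\<^sub>,\<^sub>\<nu>\<^sub>\<ge>\<^sub>1 c k \<nu> W\<^sub>k(x) W\<^sub>\<nu>(y)\<close> is represented by its coefficients;
  the values of \<open>c\<close> with an index \<open>0\<close> are never used.\<close>

definition rect_partial_sum ::
    "(nat \<Rightarrow> nat \<Rightarrow> real) \<Rightarrow> nat \<Rightarrow> nat \<Rightarrow> real \<times> real \<Rightarrow> real" where
  "rect_partial_sum c n m = (\<lambda>(x, y). \<Sum>k=1..n. \<Sum>\<nu>=1..m. c k \<nu> * walsh k x * walsh \<nu> y)"

definition spherical_partial_sum ::
    "(nat \<Rightarrow> nat \<Rightarrow> real) \<Rightarrow> real \<Rightarrow> real \<times> real \<Rightarrow> real" where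
  "spherical_partial_sum c R = (\<lambda>(x, y).
     \<Sum>(k, \<nu>) \<in> {(k, \<nu>). 1 \<le> k \<and> 1 \<le> \<nu> \<and> (real k)\<^sup>2 + (real \<nu>)\<^sup>2 \<le> R\<^sup>2}.
       c k \<nu> * walsh k x * walsh \<nu> y)"

lemma finite_spherical_index_set:
  "finite {(k, \<nu>). 1 \<le> k \<and> 1 \<le> \<nu> \<and> (real k)\<^sup>2 + (real \<nu>)\<^sup>2 \<le> R\<^sup>2}"
proof (rule finite_subset)
  have *: "k \<le> nat \<lceil>\<bar>R\<bar>\<rceil>" if "(real k)\<^sup>2 \<le> R\<^sup>2" for k
  proof -
    have "real k \<le> \<bar>R\<bar>"
      using that abs_le_square_iff [of "real k" R] by simp
    then show ?thesis
      by linarith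
  qed
  show "{(k, \<nu>). 1 \<le> k \<and> 1 \<le> \<nu> \<and> (real k)\<^sup>2 + (real \<nu>)\<^sup>2 \<le> R\<^sup>2}
      \<subseteq> {..nat \<lceil>\<bar>R\<bar>\<rceil>} \<times> {..nat \<lceil>\<bar>R\<bar>\<rceil>}"
    by (auto intro!: * intro: order_trans [rotated])
qed simp

text \<open>Convergence along \<open>sequentially \<times>\<^sub>F sequentially\<close> is convergence as \<open>min n m \<rightarrow> \<infinity>\<close>.\<close>

definition universal_subseries ::
    "(real \<times> real \<Rightarrow> real) \<Rightarrow> (nat \<Rightarrow> nat \<Rightarrow> real) \<Rightarrow> bool" where
  "universal_subseries \<mu> c \<longleftrightarrow>
     (\<forall>f \<in> weighted_L1 \<mu>. \<exists>\<delta> :: nat \<Rightarrow> nat \<Rightarrow> real.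
        (\<forall>k \<nu>. \<delta> k \<nu> \<in> {0, 1}) \<and>
        ((\<lambda>(n, m). weighted_norm \<mu> (\<lambda>p. rect_partial_sum (\<lambda>k \<nu>. \<delta> k \<nu> * c k \<nu>) n m p - f p))
           \<longlongrightarrow> 0) (sequentially \<times>\<^sub>F sequentially) \<and>
        ((\<lambda>R. weighted_norm \<mu> (\<lambda>p. spherical_partial_sum (\<lambda>k \<nu>. \<delta> k \<nu> * c k \<nu>) R p - f p))
           \<longlongrightarrow> 0) at_top)"

end

theory Submission
  imports Defs
begin

text \<open>For a step function \<open>F\<close> that is constant on the dyadic squares of side \<open>2\<^sup>-\<^sup>d\<close>, multiply the
  indicator of each square by \<open>F g(2\<^sup>t x) g(2\<^sup>t y)\<close>, where \<open>g = - \<Sum> W\<^sub>k\<close> over \<open>1 \<le> k < 2\<^sup>s\<close> is \<open>1\<close> off an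
  interval of length \<open>2\<^sup>-\<^sup>s\<close>, and let \<open>t\<close> increase from square to square so fast that the frequencies
  of different squares lie in disjoint diagonal blocks \<open>[N, N') \<times> [N, N')\<close>. The sum agrees with \<open>F\<close> off a
  set of measure \<open>2\<^sup>1\<^sup>-\<^sup>s\<close>. Its coefficients are at most \<open>4\<^sup>-\<^sup>d \<bar>F\<bar>\<close> in absolute value, so that for fixed \<open>s\<close> and
  \<open>q > 2\<close> the sum of their \<open>q\<close>-th powers vanishes as \<open>d \<rightarrow> \<infinity>\<close>.

  A rectangle or a disc of indices contains all diagonal blocks up to some point, cuts one block, and
  misses all later ones. Hence a partial sum is a sum of complete blocks plus a part of a single block,
  and by orthonormality that part has \<open>L\<^sup>2\<close> norm at most \<open>2\<^sup>s\<^sup>-\<^sup>d max \<bar>F\<bar>\<close>, which is small whatever part it is.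

  Doing this for a sequence of step functions in which each member of a countable dense set recurs
  infinitely often gives the series. The weight is small on the exceptional sets, and a subseries for
  \<open>f\<close> is found by taking a block whenever this halves the norm of the current residual.\<close>

section \<open>Walsh functions and dyadic cells\<close>

lemma rademacher_cases: "rademacher m x = 1 \<or> rademacher m x = - 1"
  by (simp add: rademacher_def)

lemma rademacher_Suc: "rademacher (Suc m) x = rademacher m (2 * x)"
  by (simp add: rademacher_def mult_ac)

text \<open>Trades the fractional part for the parity of an integer, which can be compared with a
  binary digit of the cell number.\<close>

lemma rademacher_0: "rademacher 0 x = (if even \<lfloor>2 * x\<rfloor> then 1 else - 1)"
proof -
  have "frac x < 1 / 2 \<longleftrightarrow> even \<lfloor>2 * x\<rfloor>"
  proof (cases "frac x < 1 / 2")
    case True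
    then have "\<lfloor>2 * x\<rfloor> = 2 * \<lfloor>x\<rfloor>"
      unfolding frac_def by linarith
    with True show ?thesis by simp
  next
    case False
    then have "\<lfloor>2 * x\<rfloor> = 2 * \<lfloor>x\<rfloor> + 1"
      unfolding frac_def by linarith
    with False show ?thesis by simp
  qed
  then show ?thesis
    by (simp add: rademacher_def)
qed

lemma finite_bit_nat: "finite {m. bit (n::nat) m}"
proof -
  have "{m. bit n m} \<subseteq> {..n}"
  proof clarsimp
    fix m assume "bit n m"
    then have "odd (n div 2 ^ m)" by (simp add: bit_iff_odd)
    then have "n div 2 ^ m \<noteq> 0" by (metis even_zero)
    then have "2 ^ m \<le> n" by (simp add: div_eq_0_iff)
    then show "m \<le> n" using less_exp[of m] by linarith
  qed
  then show ?thesis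
    using finite_subset by blast
qed

lemma walsh_0 [simp]: "walsh 0 x = 1"
  by (simp add: walsh_def)

text \<open>Splits off the lowest binary digit of \<open>n\<close>: the other digits, moved down by
  one place, are those of \<open>n div 2\<close>, and shifting a Rademacher index doubles the
  argument.\<close>

lemma walsh_rec: "walsh n x = (if odd n then rademacher 0 x else 1) * walsh (n div 2) (2 * x)"
proof -
  have *: "{m. bit n m} = (if odd n then {0} else {}) \<union> Suc ` {m. bit (n div 2) m}"
  proof (rule set_eqI)
    fix m show "m \<in> {m. bit n m} \<longleftrightarrow> m \<in> (if odd n then {0} else {}) \<union> Suc ` {m. bit (n div 2) m}"
      by (cases m) (auto simp: bit_0 bit_Suc)
  qed
  have "(\<Prod>m\<in>Suc ` {m. bit (n div 2) m}. rademacher m x) = walsh (n div 2) (2 * x)"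
    by (simp add: prod.reindex walsh_def rademacher_Suc)
  then show ?thesis
    unfolding walsh_def [of n] * by (simp add: prod.union_disjoint finite_bit_nat)
qed

lemma walsh_double: "walsh (2 * n) x = walsh n (2 * x)"
  by (subst walsh_rec) simp

lemma walsh_Suc_double: "walsh (Suc (2 * n)) x = rademacher 0 x * walsh n (2 * x)"
  by (subst walsh_rec) simp

lemma abs_walsh [simp]: "\<bar>walsh n x\<bar> = 1"
  unfolding walsh_def abs_prod
proof (rule prod.neutral, rule ballI)
  fix m show "\<bar>rademacher m x\<bar> = 1" using rademacher_cases [of m x] by auto
qed

text \<open>The digits of \<open>i\<close> lie below position \<open>t\<close> and those of
  \<open>2 ^ t * k\<close> at or above it, so no Rademacher factor is shared. In the bumps below,
  the low digits localise and the high digits oscillate.\<close>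

lemma walsh_add: "i < 2 ^ t \<Longrightarrow> walsh (i + 2 ^ t * k) x = walsh i x * walsh k (2 ^ t * x)"
proof (induction t arbitrary: i x)
  case (Suc t)
  have "(i + 2 ^ Suc t * k) div 2 = i div 2 + 2 ^ t * k"
    by (simp add: div_add1_eq)
  then have "walsh (i + 2 ^ Suc t * k) x
      = (if odd i then rademacher 0 x else 1) * walsh (i div 2 + 2 ^ t * k) (2 * x)"
    by (subst walsh_rec) simp
  also have "\<dots> = ((if odd i then rademacher 0 x else 1) * walsh (i div 2) (2 * x)) * walsh k (2 ^ t * (2 * x))"
    using Suc.prems by (subst Suc.IH) auto
  also have "\<dots> = walsh i x * walsh k (2 ^ Suc t * x)"
    by (subst walsh_rec [of i]) (simp add: mult_ac)
  finally show ?case .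
qed simp

lemma walsh_measurable [measurable]: "walsh n \<in> borel_measurable borel"
  unfolding walsh_def [abs_def] rademacher_def frac_def by measurable

text \<open>Reduction modulo \<open>2 ^ d\<close> makes this 1-periodic on the whole line, so that
  dilated arguments such as \<open>2 ^ t * x\<close> can be inserted directly.\<close>

definition cell :: "nat \<Rightarrow> real \<Rightarrow> nat" where
  "cell d x = nat (\<lfloor>2 ^ d * x\<rfloor> mod 2 ^ d)"

lemma cell_less: "cell d x < 2 ^ d"
  by (simp add: cell_def nat_less_iff)

lemma cell_measurable [measurable]: "cell d \<in> borel \<rightarrow>\<^sub>M count_space UNIV"
  unfolding cell_def [abs_def] by measurable

lemma cell_corner:
  assumes "i < 2 ^ d"
  shows "cell d (real i / 2 ^ d) = i"
proof -
  have "\<lfloor>2 ^ d * (real i / 2 ^ d)\<rfloor> = int i" by simp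
  then have "cell d (real i / 2 ^ d) = nat (int i mod int (2 ^ d))"
    unfolding cell_def by simp
  also have "\<dots> = i"
    using assms by (simp only: zmod_int [symmetric] nat_int mod_less)
  finally show ?thesis .
qed

lemma cell_0 [simp]: "cell 0 x = 0"
  by (simp add: cell_def)

text \<open>The cell number consists of the first \<open>d + 1\<close> binary digits of the
  fractional part. The leading one is the sign of \<open>rademacher 0\<close>, and the others form
  the cell number of \<open>2 * x\<close>.\<close>

lemma cell_Suc_eq_iff:
  "cell (Suc d) x = cell (Suc d) y \<longleftrightarrow>
     rademacher 0 x = rademacher 0 y \<and> cell d (2 * x) = cell d (2 * y)"
proof -
  have fl: "\<lfloor>2 * z\<rfloor> = \<lfloor>2 ^ Suc d * z\<rfloor> div 2 ^ d" for z :: real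
  proof -
    have "\<lfloor>2 * z\<rfloor> = \<lfloor>2 ^ Suc d * z / real_of_int (2 ^ d)\<rfloor>" by simp
    also have "\<dots> = \<lfloor>2 ^ Suc d * z\<rfloor> div 2 ^ d"
      by (rule floor_divide_real_eq_div) simp
    finally show ?thesis .
  qed
  have iff: "a mod 2 ^ Suc d = b mod 2 ^ Suc d \<longleftrightarrow>
      (even (a div 2 ^ d) \<longleftrightarrow> even (b div 2 ^ d)) \<and> a mod 2 ^ d = b mod 2 ^ d" for a b :: int
  proof -
    have ext: "a = b \<longleftrightarrow> (\<forall>n. bit a n \<longleftrightarrow> bit b n)" for a b :: int
      by (simp add: bit_eq_iff)
    have "take_bit (Suc d) a = take_bit (Suc d) b \<longleftrightarrow>
        (bit a d \<longleftrightarrow> bit b d) \<and> take_bit d a = take_bit d b"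
      unfolding ext bit_take_bit_iff less_Suc_eq by blast
    then show ?thesis
      unfolding take_bit_eq_mod bit_iff_odd by blast
  qed
  have cell_iff: "cell e u = cell e v \<longleftrightarrow> \<lfloor>2 ^ e * u\<rfloor> mod 2 ^ e = \<lfloor>2 ^ e * v\<rfloor> mod 2 ^ e" for e u v
    unfolding cell_def by (rule eq_nat_nat_iff) simp_all
  have shift: "2 ^ d * (2 * z) = 2 ^ Suc d * z" for z :: real
    by simp
  have sign: "rademacher 0 x = rademacher 0 y \<longleftrightarrow> (even \<lfloor>2 * x\<rfloor> \<longleftrightarrow> even \<lfloor>2 * y\<rfloor>)"
    unfolding rademacher_0 by (cases "even \<lfloor>2 * x\<rfloor>"; cases "even \<lfloor>2 * y\<rfloor>") auto
  show ?thesis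
    unfolding cell_iff iff sign shift fl ..
qed

lemma sum_lessThan_double: "(\<Sum>k<2 * n. f k) = (\<Sum>k<n. f (2 * k) + f (Suc (2 * k)))"
  for f :: "nat \<Rightarrow> 'a::comm_monoid_add"
  by (induction n) (simp_all add: add_ac)

text \<open>This is the dyadic Dirichlet kernel. Pairing the frequencies \<open>2 * k\<close> and
  \<open>2 * k + 1\<close> splits off a factor \<open>1 + rademacher 0 u * rademacher 0 x\<close>,
  which is 2 or 0 according to whether the first digits of \<open>u\<close> and \<open>x\<close>
  agree.\<close>

lemma walsh_kernel:
  "(\<Sum>k<2 ^ d. walsh k u * walsh k x) = (if cell d x = cell d u then 2 ^ d else 0)"
proof (induction d arbitrary: u x)
  case (Suc d)
  have "(\<Sum>k<2 ^ Suc d. walsh k u * walsh k x)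
      = (1 + rademacher 0 u * rademacher 0 x) * (\<Sum>k<2 ^ d. walsh k (2 * u) * walsh k (2 * x))"
    unfolding power_Suc sum_lessThan_double walsh_double walsh_Suc_double sum_distrib_left
    by (intro sum.cong) (simp_all add: algebra_simps)
  then show ?case
    unfolding Suc.IH cell_Suc_eq_iff
    using rademacher_cases [of 0 u] rademacher_cases [of 0 x] by auto
qed simp

lemma cell_eq_mono:
  "\<lbrakk>cell d x = cell d y; d' \<le> d\<rbrakk> \<Longrightarrow> cell d' x = cell d' y"
proof (induction d' arbitrary: d x y)
  case (Suc d')
  then obtain e where "d = Suc e" by (cases d) auto
  with Suc.prems have "rademacher 0 x = rademacher 0 y" "cell d' (2 * x) = cell d' (2 * y)"
    using Suc.IH [of e "2 * x" "2 * y"] by (simp_all add: cell_Suc_eq_iff)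
  then show ?case by (simp add: cell_Suc_eq_iff)
qed simp

section \<open>Integrals of Walsh functions over the unit interval\<close>

lemma rademacher_plus_1: "rademacher m (x + 1) = rademacher m x"
proof -
  have "frac (2 ^ m * (x + 1)) = frac (2 ^ m * x)"
  proof -
    have "2 ^ m * (x + 1) = 2 ^ m * x + of_int (2 ^ m)" by (simp add: algebra_simps)
    then show ?thesis by (simp only: frac_def floor_add_int) simp
  qed
  then show ?thesis by (simp add: rademacher_def)
qed

lemma walsh_plus_1: "walsh n (x + 1) = walsh n x"
  by (simp add: walsh_def rademacher_plus_1)

lemma unit_integrable:
  fixes f :: "real \<Rightarrow> real"
  assumes [measurable]: "f \<in> borel_measurable borel" and bound: "\<And>x. \<bar>f x\<bar> \<le> B"
  shows "set_integrable lborel {0..<1} f"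
  unfolding set_integrable_def
  by (rule integrableI_bounded_set_indicator [where B = B]) (use bound in auto)

text \<open>An affine substitution on each half of the interval. Together with
  \<open>walsh_half\<close> it reduces an integral of Walsh functions to the halved indices.\<close>

lemma unit_integral_halves:
  fixes h :: "real \<Rightarrow> real"
  assumes [measurable]: "h \<in> borel_measurable borel" and bound: "\<And>x. \<bar>h x\<bar> \<le> B"
  shows "(LBINT x:{0..<1}. h x) = ((LBINT x:{0..<1}. h (x / 2)) + (LBINT x:{0..<1}. h ((x + 1) / 2))) / 2"
proof -
  have sub: "set_integrable lborel S h" if "S \<in> sets borel" "S \<subseteq> {0..<1}" for S
    by (rule set_integrable_subset [OF unit_integrable [OF assms]]) (use that in auto)
  have "{0..<1::real} = {0..<1/2} \<union> {1/2..<1}" by auto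
  then have "(LBINT x:{0..<1}. h x) = (LBINT x:{0..<1/2}. h x) + (LBINT x:{1/2..<1}. h x)"
    using set_integral_Un [of "{0..<1/2::real}" "{1/2..<1}" lborel h] sub by auto
  also have "(LBINT x:{0..<1/2}. h x) = (LBINT x:{0..<1}. h (x / 2)) / 2"
  proof -
    have "indicator {0..<1/2} (0 + (1/2) * x) = (indicator {0..<1} x :: real)" for x :: real
      by (auto simp: indicator_def)
    then show ?thesis
      unfolding set_lebesgue_integral_def
      by (subst lborel_integral_real_affine [where c = "1/2" and t = 0]) simp_all
  qed
  also have "(LBINT x:{1/2..<1}. h x) = (LBINT x:{0..<1}. h ((x + 1) / 2)) / 2"
  proof -
    have *: "indicator {1/2..<1} ((x + 1) / 2) = (indicator {0..<1} x :: real)" for x :: real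
      by (auto simp: indicator_def)
    have **: "1/2 + (1/2) * x = (x + 1) / 2" for x :: real by simp
    show ?thesis
      unfolding set_lebesgue_integral_def
      by (subst lborel_integral_real_affine [where c = "1/2" and t = "1/2"]) (simp_all only: **, simp_all add: *)
  qed
  finally show ?thesis by simp
qed

text \<open>Doubling the argument gives \<open>x\<close> or \<open>x + 1\<close>, and periodicity
  absorbs the shift; only the sign of \<open>rademacher 0\<close> distinguishes the two
  halves.\<close>

lemma walsh_half:
  assumes "0 \<le> x" "x < 1"
  shows "walsh n (x / 2) = walsh (n div 2) x"
    and "walsh n ((x + 1) / 2) = (if odd n then - 1 else 1) * walsh (n div 2) x"
proof -
  have "rademacher 0 (x / 2) = 1" "rademacher 0 ((x + 1) / 2) = - 1"
    using assms by (simp_all add: rademacher_def frac_eq [THEN iffD2])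
  then show "walsh n (x / 2) = walsh (n div 2) x"
    and "walsh n ((x + 1) / 2) = (if odd n then - 1 else 1) * walsh (n div 2) x"
    using walsh_plus_1 [of "n div 2" x]
    by (subst walsh_rec; simp add: add_divide_distrib; fail)+
qed

text \<open>Induction by halving both indices: the two halves of the interval cancel if the lowest
  digits differ, and contribute equally otherwise. Halving does not decrease
  \<open>n + m = 0\<close>, which is therefore computed directly.\<close>

lemma walsh_orthonormal:
  "(LBINT x:{0..<1}. walsh n x * walsh m x) = of_bool (n = m)"
proof (induction "n + m" arbitrary: n m rule: less_induct)
  case less
  let ?\<sigma> = "if even n \<longleftrightarrow> even m then 1 else - 1 :: real"
  have 1: "(LBINT x:{0..<1}. walsh n (x / 2) * walsh m (x / 2))
      = (LBINT x:{0..<1}. walsh (n div 2) x * walsh (m div 2) x)"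
    by (rule set_lebesgue_integral_cong) (auto simp: walsh_half)
  have "(LBINT x:{0..<1}. walsh n ((x + 1) / 2) * walsh m ((x + 1) / 2))
      = (LBINT x:{0..<1}. ?\<sigma> * (walsh (n div 2) x * walsh (m div 2) x))"
    by (rule set_lebesgue_integral_cong) (auto simp: walsh_half)
  also have "\<dots> = ?\<sigma> * (LBINT x:{0..<1}. walsh (n div 2) x * walsh (m div 2) x)"
    by (rule set_integral_mult_right)
  finally have "(LBINT x:{0..<1}. walsh n x * walsh m x)
      = (1 + ?\<sigma>) / 2 * (LBINT x:{0..<1}. walsh (n div 2) x * walsh (m div 2) x)"
    using 1 by (subst unit_integral_halves [where B = 1]) (simp_all add: abs_mult algebra_simps)
  moreover have "(LBINT x:{0..<1}. walsh (n div 2) x * walsh (m div 2) x) = of_bool (n div 2 = m div 2)"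
    if "0 < n + m"
    using that by (intro less) auto
  moreover have "(LBINT x:{0..<1::real}. 1::real) = 1"
    by (simp add: set_lebesgue_integral_def)
  moreover have "n = m \<longleftrightarrow> (even n \<longleftrightarrow> even m) \<and> n div 2 = m div 2"
    by (metis even_two_times_div_two odd_two_times_div_two_succ)
  ultimately show ?case
    by (cases "n + m = 0") auto
qed

lemma walsh_integral: "(LBINT x:{0..<1}. walsh n x) = of_bool (n = 0)"
  using walsh_orthonormal [of n 0] by simp

section \<open>Integration over the unit square and Walsh polynomials in two variables\<close>

lemma unit_square_borel [measurable]: "unit_square \<in> sets borel"
  unfolding unit_square_def by (intro borel_closed closed_Times) auto

lemma space_unit_square [simp]: "space (lebesgue_on unit_square) = unit_square"
  by (simp add: space_restrict_space)

lemma emeasure_unit_square: "emeasure lborel unit_square = 1"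
proof -
  have "emeasure (lborel \<Otimes>\<^sub>M lborel) ({0..1::real} \<times> {0..1::real}) = 1"
    by (subst lborel.emeasure_pair_measure_Times) simp_all
  then show ?thesis
    by (simp add: lborel_prod unit_square_def)
qed

lemma borel_imp_lebesgue_on:
  fixes f :: "real \<times> real \<Rightarrow> 'a::topological_space"
  shows "f \<in> borel_measurable borel \<Longrightarrow> f \<in> borel_measurable (lebesgue_on S)"
  by (intro measurable_restrict_space1 measurable_completion) simp

lemma nn_integral_unit_square:
  "(\<integral>\<^sup>+ p. f p \<partial>lebesgue_on unit_square) = (\<integral>\<^sup>+ p. f p * indicator unit_square p \<partial>lborel)"
  by (subst nn_integral_restrict_space) (auto simp: nn_integral_completion)

lemma square_integrable:
  fixes f :: "real \<times> real \<Rightarrow> real"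
  assumes [measurable]: "f \<in> borel_measurable borel" and bound: "\<And>p. \<bar>f p\<bar> \<le> B"
  shows "set_integrable lborel unit_square f"
  unfolding set_integrable_def
  by (rule integrableI_bounded_set_indicator [where B = B])
    (use bound emeasure_unit_square in auto)

text \<open>Fubini's theorem. The half-open interval suits dyadic intervals while the square is
  closed; the endpoint 1 is a null set.\<close>

lemma square_integral_product:
  fixes f g :: "real \<Rightarrow> real"
  assumes [measurable]: "f \<in> borel_measurable borel" "g \<in> borel_measurable borel"
    and bf: "\<And>x. \<bar>f x\<bar> \<le> A" and bg: "\<And>x. \<bar>g x\<bar> \<le> B"
  shows "(LBINT p:unit_square. f (fst p) * g (snd p)) = (LBINT x:{0..<1}. f x) * (LBINT y:{0..<1}. g y)"
proof -
  let ?F = "\<lambda>x. indicator {0..1} x *\<^sub>R f x" and ?G = "\<lambda>y. indicator {0..1} y *\<^sub>R g y"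
  have int: "integrable (lborel \<Otimes>\<^sub>M lborel) (\<lambda>(x, y). ?F x * ?G y)"
  proof -
    have [measurable]: "(\<lambda>p. f (fst p)) \<in> borel_measurable (borel :: (real \<times> real) measure)"
       "(\<lambda>p. g (snd p)) \<in> borel_measurable (borel :: (real \<times> real) measure)"
      by (intro measurable_compose [OF _ assms(1)] measurable_compose [OF _ assms(2)]; simp add: borel_prod [symmetric])+
    have "set_integrable lborel unit_square (\<lambda>p. f (fst p) * g (snd p))"
      by (rule square_integrable [where B = "A * B"]) 
        (auto simp: abs_mult intro!: mult_mono bf bg order_trans [OF abs_ge_zero bf])
    then show ?thesis
      unfolding set_integrable_def lborel_prod
      by (rule Bochner_Integration.integrable_cong [THEN iffD1, rotated -1])
        (auto simp: unit_square_def indicator_def)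
  qed
  have "(LBINT p:unit_square. f (fst p) * g (snd p)) = (LINT p|(lborel \<Otimes>\<^sub>M lborel). (case p of (x, y) \<Rightarrow> ?F x * ?G y))"
    unfolding set_lebesgue_integral_def lborel_prod
    by (rule Bochner_Integration.integral_cong) (auto simp: unit_square_def indicator_def)
  also have "\<dots> = (LINT x|lborel. LINT y|lborel. ?F x * ?G y)"
    using lborel_pair.integral_fst' [OF int] by simp
  also have "\<dots> = (LINT x|lborel. ?F x) * (LINT y|lborel. ?G y)"
    by simp
  also have "(LINT x|lborel. ?F x) = (LBINT x:{0..<1}. f x)"
    unfolding set_lebesgue_integral_def
    by (rule integral_cong_AE) (use AE_lborel_singleton [of "1::real"] in \<open>auto simp: indicator_def\<close>)
  also have "(LINT x|lborel. ?G x) = (LBINT x:{0..<1}. g x)"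
    unfolding set_lebesgue_integral_def
    by (rule integral_cong_AE) (use AE_lborel_singleton [of "1::real"] in \<open>auto simp: indicator_def\<close>)
  finally show ?thesis .
qed

text \<open>One form for all partial sums: rectangles, discs and blocks differ only in the index set
  \<open>A\<close>.\<close>

definition wsum :: "(nat \<times> nat) set \<Rightarrow> (nat \<Rightarrow> nat \<Rightarrow> real) \<Rightarrow> real \<times> real \<Rightarrow> real" where
  "wsum A a p = (\<Sum>(k, l)\<in>A. a k l * walsh k (fst p) * walsh l (snd p))"

lemma walsh_fst_measurable [measurable]: "(\<lambda>p. walsh n (fst p)) \<in> borel_measurable (borel :: (real \<times> real) measure)"
  and walsh_snd_measurable [measurable]: "(\<lambda>p. walsh n (snd p)) \<in> borel_measurable (borel :: (real \<times> real) measure)"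
  by (intro measurable_compose [OF _ walsh_measurable]; simp add: borel_prod [symmetric])+

lemma wsum_measurable [measurable]: "wsum A a \<in> borel_measurable borel"
  unfolding wsum_def [abs_def] case_prod_beta by measurable

text \<open>A crude bound from the fact that Walsh functions have modulus 1. It serves for
  integrability and, in the end, to decide how small the weight has to be on the exceptional
  sets.\<close>

lemma abs_wsum_le:
  "\<bar>wsum A a p\<bar> \<le> (\<Sum>(k, l)\<in>A. \<bar>a k l\<bar>)"
  unfolding wsum_def by (rule order_trans [OF sum_abs]) (simp add: case_prod_beta abs_mult)

lemma set_integral_double_sum:
  fixes g :: "'b \<Rightarrow> 'c \<Rightarrow> 'a \<Rightarrow> real"
  assumes "\<And>u v. set_integrable M S (g u v)"
  shows "(LINT x:S|M. (\<Sum>u\<in>A. \<Sum>v\<in>B. g u v x)) = (\<Sum>u\<in>A. \<Sum>v\<in>B. LINT x:S|M. g u v x)"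
  using assms unfolding set_lebesgue_integral_def set_integrable_def scaleR_sum_right
  by (simp add: Bochner_Integration.integral_sum Bochner_Integration.integrable_sum)

text \<open>Parseval's identity: the square is expanded into a double sum, each integral factors
  over the two variables, and off the diagonal one of the factors vanishes.\<close>

lemma square_integral_wsum_squared:
  assumes "finite A"
  shows "(LBINT p:unit_square. (wsum A a p)\<^sup>2) = (\<Sum>(k, l)\<in>A. (a k l)\<^sup>2)"
proof -
  let ?g = "\<lambda>u v p. (a (fst u) (snd u) * a (fst v) (snd v)) *
    ((walsh (fst u) (fst p) * walsh (fst v) (fst p)) * (walsh (snd u) (snd p) * walsh (snd v) (snd p)))"
  have int: "set_integrable lborel unit_square (\<lambda>p. ?g u v p)" for u v
    by (rule square_integrable [where B = "\<bar>a (fst u) (snd u) * a (fst v) (snd v)\<bar>"]) (auto simp: abs_mult)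
  have val: "(LBINT p:unit_square. ?g u v p) = (if v = u then (a (fst u) (snd u))\<^sup>2 else 0)" for u v
    unfolding set_integral_mult_right
    by (subst square_integral_product [where A = 1 and B = 1])
      (auto simp: abs_mult walsh_orthonormal power2_eq_square prod_eq_iff)
  have "(wsum A a p)\<^sup>2 = (\<Sum>u\<in>A. \<Sum>v\<in>A. ?g u v p)" for p
    by (simp add: wsum_def case_prod_beta power2_eq_square sum_product mult_ac)
  then have "(LBINT p:unit_square. (wsum A a p)\<^sup>2) = (\<Sum>u\<in>A. \<Sum>v\<in>A. LBINT p:unit_square. ?g u v p)"
    by (simp only: set_integral_double_sum [OF int])
  also have "\<dots> = (\<Sum>(k, l)\<in>A. (a k l)\<^sup>2)"
    unfolding val using assms by (simp add: case_prod_beta)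
  finally show ?thesis .
qed

text \<open>On a space of measure 1 the L^1 norm is at most the L^2 norm. The pointwise inequality
  \<open>amgm\<close> stands in for the Cauchy-Schwarz inequality.\<close>

lemma wsum_L1_bound:
  assumes "finite A" "0 < \<Lambda>" and le: "(\<Sum>(k, l)\<in>A. (a k l)\<^sup>2) \<le> \<Lambda>\<^sup>2"
  shows "(\<integral>\<^sup>+ p. ennreal \<bar>wsum A a p\<bar> \<partial>lebesgue_on unit_square) \<le> ennreal \<Lambda>"
proof -
  let ?S = "wsum A a"
  have bd: "\<bar>?S p\<bar> \<le> (\<Sum>(k, l)\<in>A. \<bar>a k l\<bar>)" for p by (rule abs_wsum_le)
  have amgm: "\<bar>s\<bar> \<le> s\<^sup>2 / (2 * \<Lambda>) + \<Lambda> / 2" for s :: real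
  proof -
    have "0 \<le> (\<bar>s\<bar> - \<Lambda>)\<^sup>2 / (2 * \<Lambda>)" using \<open>0 < \<Lambda>\<close> by simp
    also have "\<dots> = s\<^sup>2 / (2 * \<Lambda>) + \<Lambda> / 2 - \<bar>s\<bar>"
      using \<open>0 < \<Lambda>\<close> by (simp add: power2_diff field_simps power2_eq_square)
    finally show ?thesis by simp
  qed
  have i1: "set_integrable lborel unit_square (\<lambda>p. \<bar>?S p\<bar>)"
    by (rule square_integrable [where B = "\<Sum>(k, l)\<in>A. \<bar>a k l\<bar>"]) (use bd in auto)
  have bd2: "\<bar>(?S p)\<^sup>2\<bar> \<le> (\<Sum>(k, l)\<in>A. \<bar>a k l\<bar>)\<^sup>2" for p
    using power_mono [OF bd [of p] abs_ge_zero, of 2] by simp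
  have i2: "set_integrable lborel unit_square (\<lambda>p. (?S p)\<^sup>2)"
    by (rule square_integrable [OF _ bd2]) measurable
  have i3: "set_integrable lborel unit_square (\<lambda>p. \<Lambda> / 2)"
    by (rule square_integrable [where B = "\<bar>\<Lambda> / 2\<bar>"]) auto
  have c: "(LBINT p:unit_square. \<Lambda> / 2) = \<Lambda> / 2"
    using emeasure_unit_square by (simp add: set_lebesgue_integral_def measure_def)
  have "(LBINT p:unit_square. \<bar>?S p\<bar>) \<le> (LBINT p:unit_square. (?S p)\<^sup>2 / (2 * \<Lambda>) + \<Lambda> / 2)"
    using i1 i2 i3 by (intro set_integral_mono amgm set_integral_add set_integrable_divide) auto
  also have "\<dots> = (LBINT p:unit_square. (?S p)\<^sup>2) / (2 * \<Lambda>) + \<Lambda> / 2"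
    using i2 i3 c by (subst set_integral_add) (auto intro!: set_integrable_divide)
  also have "\<dots> \<le> \<Lambda>\<^sup>2 / (2 * \<Lambda>) + \<Lambda> / 2"
    using le \<open>0 < \<Lambda>\<close> assms(1) by (simp add: square_integral_wsum_squared divide_right_mono)
  also have "\<dots> = \<Lambda>"
    using \<open>0 < \<Lambda>\<close> by (simp add: power2_eq_square)
  finally have "(LBINT p:unit_square. \<bar>?S p\<bar>) \<le> \<Lambda>" .
  moreover have "(\<integral>\<^sup>+ p. ennreal \<bar>?S p\<bar> \<partial>lebesgue_on unit_square) = ennreal (LBINT p:unit_square. \<bar>?S p\<bar>)"
    unfolding nn_integral_unit_square set_lebesgue_integral_def
    by (subst nn_integral_eq_integral [symmetric])
      (use i1 in \<open>auto simp: set_integrable_def ennreal_mult' ennreal_indicator mult.commute intro!: nn_integral_cong\<close>)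
  ultimately show ?thesis
    by (simp add: ennreal_leI)
qed

section \<open>Bumps in one variable\<close>

text \<open>The Walsh coefficients of \<open>x \<mapsto> \<chi>(x) (1 - D(2\<^sup>t x))\<close>, where \<open>\<chi>\<close> is the indicator of the dyadic
  interval of length \<open>2\<^sup>-\<^sup>d\<close> that contains \<open>u\<close>, and \<open>D\<close> is the sum of the first \<open>2\<^sup>s\<close> Walsh functions.\<close>

definition bump_coeff :: "nat \<Rightarrow> nat \<Rightarrow> nat \<Rightarrow> real \<Rightarrow> nat \<Rightarrow> real" where
  "bump_coeff t d s u k =
     (if k mod 2 ^ t < 2 ^ d \<and> 1 \<le> k div 2 ^ t \<and> k div 2 ^ t < 2 ^ s
      then - (walsh (k mod 2 ^ t) u / 2 ^ d) else 0)"

text \<open>Division with remainder by \<open>2 ^ t\<close> is a bijection from the support onto the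
  pairs \<open>(j, i)\<close>; the condition \<open>d \<le> t\<close> ensures that every
  \<open>i < 2 ^ d\<close> is a possible remainder.\<close>

lemma sum_bump_support:
  fixes h :: "nat \<Rightarrow> nat \<Rightarrow> real"
  assumes "d \<le> t"
  shows "(\<Sum>k::nat<2 ^ (t + s). if k mod 2 ^ t < 2 ^ d \<and> 1 \<le> k div 2 ^ t \<and> k div 2 ^ t < 2 ^ s
      then h (k mod 2 ^ t) (k div 2 ^ t) else 0) = (\<Sum>j\<in>{1..<2 ^ s}. \<Sum>i<2 ^ d. h i j)"
proof -
  have le: "(2::nat) ^ d \<le> 2 ^ t"
    using assms by simp
  have "(\<Sum>k::nat<2 ^ (t + s). if k mod 2 ^ t < 2 ^ d \<and> 1 \<le> k div 2 ^ t \<and> k div 2 ^ t < 2 ^ s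
      then h (k mod 2 ^ t) (k div 2 ^ t) else 0)
    = (\<Sum>k\<in>{k\<in>{..<2 ^ (t + s)}. k mod 2 ^ t < 2 ^ d \<and> 1 \<le> k div 2 ^ t \<and> k div 2 ^ t < 2 ^ s}.
        h (k mod 2 ^ t) (k div 2 ^ t))"
    by (rule sum.inter_filter [symmetric]) simp
  also have "\<dots> = (\<Sum>(j, i)\<in>{1..<(2::nat) ^ s} \<times> {..<(2::nat) ^ d}. h i j)"
  proof (rule sum.reindex_bij_witness [where i = "\<lambda>(j, i). i + 2 ^ t * j :: nat" and j = "\<lambda>k. (k div 2 ^ t, k mod 2 ^ t)"])
    fix b assume "b \<in> {1..<(2::nat) ^ s} \<times> {..<(2::nat) ^ d}"
    then obtain i j where b: "b = (j, i)" "1 \<le> j" "j < 2 ^ s" "i < 2 ^ d" by auto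
    then have i: "i < 2 ^ t" using le by linarith
    then have "i + 2 ^ t * j < 2 ^ t * Suc j" by simp
    also have "\<dots> \<le> 2 ^ t * 2 ^ s" using b by (intro mult_le_mono) auto
    finally have "i + 2 ^ t * j < 2 ^ (t + s)" by (simp add: power_add)
    then show "(case b of (j, i) \<Rightarrow> i + 2 ^ t * j) \<in> {k \<in> {..<2 ^ (t + s)}.
        k mod 2 ^ t < 2 ^ d \<and> 1 \<le> k div 2 ^ t \<and> k div 2 ^ t < 2 ^ s}"
      and "((case b of (j, i) \<Rightarrow> i + 2 ^ t * j) div 2 ^ t, (case b of (j, i) \<Rightarrow> i + 2 ^ t * j) mod 2 ^ t) = b"
      using i b by auto
  qed auto
  also have "\<dots> = (\<Sum>j\<in>{1..<2 ^ s}. \<Sum>i<2 ^ d. h i j)"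
    by (simp add: sum.cartesian_product)
  finally show ?thesis .
qed

text \<open>The constant terms in \<open>1 - D\<close> cancel, so no frequency is below
  \<open>2 ^ t\<close>. Hence raising \<open>t\<close> by \<open>s\<close> moves a bump into a fresh
  range of frequencies.\<close>

lemma bump_coeff_support:
  assumes "bump_coeff t d s u k \<noteq> 0"
  shows "2 ^ t \<le> k" "k < 2 ^ (t + s)"
proof -
  have k: "1 \<le> k div 2 ^ t" "k div 2 ^ t < 2 ^ s"
    using assms by (auto simp: bump_coeff_def split: if_splits)
  then show "2 ^ t \<le> k"
    by (simp add: Suc_le_eq div_greater_zero_iff)
  show "k < 2 ^ (t + s)"
    using k(2) by (simp add: power_add mult.commute less_mult_imp_div_less div_less_iff_less_mult)
qed

lemma abs_bump_coeff_le: "\<bar>bump_coeff t d s u k\<bar> \<le> 1 / 2 ^ d"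
  by (simp add: bump_coeff_def)

text \<open>All nonzero coefficients have the same size \<open>1 / 2 ^ d\<close>, and there are
  \<open>(2 ^ s - 1) * 2 ^ d\<close> of them.\<close>

lemma sum_bump_coeff_power:
  assumes "d \<le> t"
  shows "(\<Sum>k<2 ^ (t + s). \<bar>bump_coeff t d s u k\<bar> powr q) \<le> 2 ^ s * 2 ^ d * (1 / 2 ^ d) powr q"
proof -
  have "(\<Sum>k<2 ^ (t + s). \<bar>bump_coeff t d s u k\<bar> powr q)
      = (\<Sum>k::nat<2 ^ (t + s). if k mod 2 ^ t < 2 ^ d \<and> 1 \<le> k div 2 ^ t \<and> k div 2 ^ t < 2 ^ s
          then (1 / 2 ^ d) powr q else 0)"
    by (intro sum.cong) (simp_all add: bump_coeff_def)
  also have "\<dots> = (\<Sum>j\<in>{1..<(2::nat) ^ s}. \<Sum>i<(2::nat) ^ d. (1 / 2 ^ d) powr q)"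
    by (rule sum_bump_support [OF assms])
  also have "\<dots> = real ((2::nat) ^ s - 1) * 2 ^ d * (1 / 2 ^ d) powr q"
    by simp
  also have "\<dots> \<le> 2 ^ s * 2 ^ d * (1 / 2 ^ d) powr q"
    by (intro mult_right_mono) (simp_all add: of_nat_diff)
  finally show ?thesis .
qed

text \<open>By \<open>walsh_add\<close> the sum factors. The low digits give the kernel at
  \<open>u\<close>, that is, the indicator of a dyadic interval; the high digits give the kernel at
  0 in the variable \<open>2 ^ t * x\<close>, without its constant term.\<close>

lemma bump_poly:
  assumes "d \<le> t"
  shows "(\<Sum>k<2 ^ (t + s). bump_coeff t d s u k * walsh k x)
    = (if cell d x = cell d u then if cell s (2 ^ t * x) = 0 then 1 - 2 ^ s else 1 else 0)"
proof -
  have "(\<Sum>k<2 ^ (t + s). bump_coeff t d s u k * walsh k x)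
      = (\<Sum>k::nat<2 ^ (t + s). if k mod 2 ^ t < 2 ^ d \<and> 1 \<le> k div 2 ^ t \<and> k div 2 ^ t < 2 ^ s
          then - (walsh (k mod 2 ^ t) u * walsh (k mod 2 ^ t) x / 2 ^ d * walsh (k div 2 ^ t) (2 ^ t * x)) else 0)"
  proof (intro sum.cong refl)
    fix k :: nat
    have "walsh k x = walsh (k mod 2 ^ t) x * walsh (k div 2 ^ t) (2 ^ t * x)"
      using walsh_add [of "k mod 2 ^ t" t "k div 2 ^ t" x] by simp
    then show "bump_coeff t d s u k * walsh k x = (if k mod 2 ^ t < 2 ^ d \<and> 1 \<le> k div 2 ^ t \<and> k div 2 ^ t < 2 ^ s
          then - (walsh (k mod 2 ^ t) u * walsh (k mod 2 ^ t) x / 2 ^ d * walsh (k div 2 ^ t) (2 ^ t * x)) else 0)"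
      by (simp add: bump_coeff_def)
  qed
  also have "\<dots> = (\<Sum>j\<in>{1..<2 ^ s}. \<Sum>i<2 ^ d. - (walsh i u * walsh i x / 2 ^ d * walsh j (2 ^ t * x)))"
    by (rule sum_bump_support [OF assms])
  also have "\<dots> = - (\<Sum>j\<in>{1..<2 ^ s}. (\<Sum>i<2 ^ d. walsh i u * walsh i x) / 2 ^ d * walsh j (2 ^ t * x))"
    by (simp add: sum_negf sum_divide_distrib sum_distrib_right)
  also have "\<dots> = - ((\<Sum>i<2 ^ d. walsh i u * walsh i x) / 2 ^ d * (\<Sum>j\<in>{1..<2 ^ s}. walsh j (2 ^ t * x)))"
    by (simp add: sum_distrib_left)
  also have "(\<Sum>j\<in>{1..<2 ^ s}. walsh j (2 ^ t * x)) = (\<Sum>j<2 ^ s. walsh j (2 ^ t * x)) - 1"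
    by (simp add: lessThan_atLeast0 sum.atLeast_Suc_lessThan)
  also have "(\<Sum>j<2 ^ s. walsh j (2 ^ t * x)) = (if cell s (2 ^ t * x) = 0 then 2 ^ s else 0)"
  proof -
    have "walsh j 0 = 1" for j
      by (simp add: walsh_def rademacher_def)
    moreover have "cell s 0 = 0" by (simp add: cell_def)
    ultimately show ?thesis
      using walsh_kernel [where d = s and u = 0 and x = "2 ^ t * x"] by simp
  qed
  finally show ?thesis
    by (simp add: walsh_kernel)
qed

text \<open>The two conditions are independent events of probabilities \<open>1 / 2 ^ d\<close> and
  \<open>1 / 2 ^ s\<close>: the product of their kernels expands into Walsh functions of index
  \<open>i + 2 ^ t * j\<close>, and only index 0 has a nonzero integral.\<close>

lemma unit_integral_bad_cell:
  assumes "d \<le> t"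
  shows "(LBINT x:{0..<1}. of_bool (cell d x = cell d u \<and> cell s (2 ^ t * x) = 0)) = (1 / (2 ^ d * 2 ^ s) :: real)"
proof -
  have w0: "walsh j 0 = 1" for j
    by (simp add: walsh_def rademacher_def)
  have c0: "cell s 0 = 0" by (simp add: cell_def)
  have int: "set_integrable lborel {0..<1} (\<lambda>x. walsh i u * walsh (i + 2 ^ t * j) x / (2 ^ d * 2 ^ s))" for i j
    by (rule unit_integrable [where B = "1 / (2 ^ d * 2 ^ s)"]) (auto simp: abs_mult)
  have "of_bool (cell d x = cell d u \<and> cell s (2 ^ t * x) = 0)
      = (\<Sum>i<2 ^ d. walsh i u * walsh i x) * (\<Sum>j<2 ^ s. walsh j 0 * walsh j (2 ^ t * x)) / (2 ^ d * 2 ^ s)" for x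
    unfolding walsh_kernel by (simp add: c0)
  also have "\<dots> x = (\<Sum>i<2 ^ d. \<Sum>j<2 ^ s. walsh i u * walsh (i + 2 ^ t * j) x / (2 ^ d * 2 ^ s))" for x
    unfolding sum_product sum_divide_distrib w0
  proof (intro sum.cong refl)
    fix i j :: nat assume "i \<in> {..<2 ^ d}"
    then have "i < 2 ^ t" using power_increasing [OF assms, of "2::nat"] by (simp del: power_increasing_iff)
    then show "walsh i u * walsh i x * (1 * walsh j (2 ^ t * x)) / (2 ^ d * 2 ^ s)
        = walsh i u * walsh (i + 2 ^ t * j) x / (2 ^ d * 2 ^ s)"
      by (simp add: walsh_add)
  qed
  finally have "(LBINT x:{0..<1}. of_bool (cell d x = cell d u \<and> cell s (2 ^ t * x) = 0))
      = (\<Sum>i<2 ^ d. \<Sum>j<2 ^ s. LBINT x:{0..<1}. walsh i u * walsh (i + 2 ^ t * j) x / (2 ^ d * 2 ^ s))"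
    by (simp only: set_integral_double_sum [OF int])
  also have "\<dots> = (\<Sum>i<(2::nat) ^ d. \<Sum>j<(2::nat) ^ s. if i = 0 then if j = 0 then 1 / (2 ^ d * 2 ^ s) else 0 else 0)"
    by (intro sum.cong refl)
      (simp add: walsh_integral w0 split: if_splits)
  also have "\<dots> = (\<Sum>i<(2::nat) ^ d. if i = 0 then 1 / (2 ^ d * 2 ^ s) else 0)"
    by (intro sum.cong refl) auto
  also have "\<dots> = 1 / (2 ^ d * 2 ^ s)"
    by simp
  finally show ?thesis .
qed

section \<open>Gluing blocks of coefficients\<close>

text \<open>The common feature of rectangles and discs of indices. For consecutive diagonal blocks
  it implies that at most one of them is cut.\<close>

definition exhausting :: "(nat \<times> nat) set \<Rightarrow> bool" where
  "exhausting A \<longleftrightarrow> finite A \<and> (\<forall>N. {1..<N} \<times> {1..<N} \<subseteq> A \<or> A \<inter> {N..} \<times> {N..} = {})"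

text \<open>For strictly increasing \<open>N\<close> and blocks supported in
  \<open>{N n..<N (Suc n)}\<close>, a nonzero \<open>a n k l\<close> forces
  \<open>n \<le> N n \<le> k\<close>. The finite sum thus reaches every relevant block, and by
  disjointness it has at most one nonzero term.\<close>

definition glue :: "(nat \<Rightarrow> nat \<Rightarrow> nat \<Rightarrow> real) \<Rightarrow> nat \<Rightarrow> nat \<Rightarrow> real" where
  "glue a k l = (\<Sum>n\<le>k. a n k l)"

lemma exhausting_square: "exhausting ({1..<M} \<times> {1..<M})"
  unfolding exhausting_def
proof (intro conjI allI)
  fix N
  show "{1..<N} \<times> {1..<N} \<subseteq> {1..<M} \<times> {1..<M} \<or> {1..<M} \<times> {1..<M} \<inter> {N..} \<times> {N..} = {}"
    by (cases "N \<le> M") auto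
qed simp

lemma glue_block:
  assumes N: "strict_mono N"
    and supp: "\<And>n k l. a n k l \<noteq> 0 \<Longrightarrow> k \<in> {N n..<N (Suc n)}"
    and k: "k \<in> {N n..<N (Suc n)}"
  shows "glue a k l = a n k l"
proof -
  have "a n' k l = 0" if "n' \<noteq> n" for n'
  proof (rule ccontr)
    assume "a n' k l \<noteq> 0"
    then have k': "k \<in> {N n'..<N (Suc n')}" by (rule supp)
    show False
    proof (cases "n' < n")
      case True
      then have "N (Suc n') \<le> N n" using N by (simp add: strict_mono_less_eq)
      with k k' show False by simp
    next
      case False
      with that have "N (Suc n) \<le> N n'" using N by (simp add: strict_mono_less_eq)
      with k k' show False by simp
    qed
  qed
  then have "glue a k l = (\<Sum>n'\<le>k. if n' = n then a n k l else 0)"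
    unfolding glue_def by (intro sum.cong) auto
  moreover have "n \<le> k"
    using strict_mono_imp_increasing [OF N, of n] k by simp
  ultimately show ?thesis by simp
qed

lemma glue_nonzero:
  assumes "glue a k l \<noteq> 0"
  obtains n where "a n k l \<noteq> 0"
  using assms unfolding glue_def by (meson sum.neutral)

text \<open>Let \<open>m\<close> be the first index for which \<open>A\<close> does not contain the
  whole square below \<open>N (Suc m)\<close>. Earlier blocks lie inside \<open>A\<close>, and since
  \<open>A\<close> is exhausting it misses all later ones. The second conclusion makes
  \<open>m\<close> large when \<open>A\<close> contains a large square.\<close>

lemma wsum_glue:
  assumes N: "strict_mono N"
    and supp: "\<And>n k l. a n k l \<noteq> 0 \<Longrightarrow> k \<in> {N n..<N (Suc n)} \<and> l \<in> {N n..<N (Suc n)}"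
    and N0: "1 \<le> N 0" and A: "exhausting A"
  shows "\<exists>m. (\<forall>p. wsum A (glue a) p = (\<Sum>n<m. wsum ({1..<N (Suc n)} \<times> {1..<N (Suc n)}) (a n) p) + wsum A (a m) p)
    \<and> (\<forall>M. {1..<N M} \<times> {1..<N M} \<subseteq> A \<longrightarrow> M \<le> m)"
proof -
  have fin: "finite A"
    and ex: "\<And>N. {1..<N} \<times> {1..<N} \<subseteq> A \<or> A \<inter> {N..} \<times> {N..} = {}"
    using A by (auto simp: exhausting_def)
  have inc: "n \<le> N n" for n
    by (rule strict_mono_imp_increasing [OF N])
  have pos: "1 \<le> N n" for n
    using N0 N by (meson le0 order_trans strict_mono_less_eq)
  \<comment> \<open>The point \<open>(Suc K, Suc K)\<close> lies outside \<open>A\<close>, so some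
    square is not contained in \<open>A\<close> and the least such index exists. Inserting 0 covers
    empty \<open>A\<close>.\<close>
  define K where "K = Max (insert 0 (fst ` A))"
  have K: "fst q \<le> K" if "q \<in> A" for q
    unfolding K_def using fin that by (intro Max_ge) auto
  define P where "P n \<longleftrightarrow> {1..<N (Suc n)} \<times> {1..<N (Suc n)} \<subseteq> A" for n
  have "\<not> P (Suc K)"
  proof
    assume "P (Suc K)"
    moreover have "(Suc K, Suc K) \<in> {1..<N (Suc (Suc K))} \<times> {1..<N (Suc (Suc K))}"
      using inc [of "Suc (Suc K)"] by auto
    ultimately have "(Suc K, Suc K) \<in> A" unfolding P_def by blast
    then show False using K by fastforce
  qed
  define m where "m = (LEAST n. \<not> P n)"
  have "\<not> P m" unfolding m_def by (rule LeastI) fact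
  have Pless: "P n" if "n < m" for n
    using not_less_Least that unfolding m_def by blast
  have le: "M \<le> m" if "{1..<N M} \<times> {1..<N M} \<subseteq> A" for M
  proof (rule ccontr)
    assume "\<not> M \<le> m"
    then have "N (Suc m) \<le> N M" using N by (simp add: strict_mono_less_eq)
    then have "P m" using that unfolding P_def by fastforce
    with \<open>\<not> P m\<close> show False ..
  qed
  have full: "wsum A (a n) p = wsum ({1..<N (Suc n)} \<times> {1..<N (Suc n)}) (a n) p" if "n < m" for n p
    unfolding wsum_def
  proof (rule sum.mono_neutral_right [OF fin])
    show "{1..<N (Suc n)} \<times> {1..<N (Suc n)} \<subseteq> A"
      using Pless [OF that] by (simp add: P_def)
    show "\<forall>i\<in>A - {1..<N (Suc n)} \<times> {1..<N (Suc n)}.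
        (case i of (k, l) \<Rightarrow> a n k l * walsh k (fst p) * walsh l (snd p)) = 0"
      using supp [of n] pos [of n] by fastforce
  qed
  have zero: "wsum A (a n) p = 0" if "m < n" for n p
    unfolding wsum_def
  proof (rule sum.neutral, clarify)
    fix k l assume "(k, l) \<in> A"
    moreover have "A \<inter> {N (Suc m)..} \<times> {N (Suc m)..} = {}"
      using ex [of "N (Suc m)"] \<open>\<not> P m\<close> by (auto simp: P_def)
    moreover have "N (Suc m) \<le> N n" using that N by (simp add: strict_mono_less_eq)
    ultimately have "a n k l = 0"
      using supp [of n k l] by fastforce
    then show "a n k l * walsh k (fst p) * walsh l (snd p) = 0" by simp
  qed
  \<comment> \<open>A common range of \<open>n\<close> for all indices in \<open>A\<close>, reaching
    beyond \<open>m\<close>, so that the two sums can be interchanged.\<close>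
  define L where "L = Suc (max K m)"
  have "wsum A (glue a) p = (\<Sum>n<m. wsum ({1..<N (Suc n)} \<times> {1..<N (Suc n)}) (a n) p) + wsum A (a m) p" for p
  proof -
    have "glue a k l = (\<Sum>n<L. a n k l)" if "(k, l) \<in> A" for k l
      unfolding glue_def
    proof (rule sum.mono_neutral_left)
      show "{..k} \<subseteq> {..<L}" using K [OF that] by (auto simp: L_def)
      show "\<forall>n\<in>{..<L} - {..k}. a n k l = 0"
      proof
        fix n assume "n \<in> {..<L} - {..k}"
        then show "a n k l = 0" using supp [of n k l] inc [of n] by fastforce
      qed
    qed simp
    then have "wsum A (glue a) p = (\<Sum>(k, l)\<in>A. (\<Sum>n<L. a n k l) * walsh k (fst p) * walsh l (snd p))"
      unfolding wsum_def by (intro sum.cong) auto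
    also have "\<dots> = (\<Sum>n<L. wsum A (a n) p)"
      unfolding wsum_def by (subst sum.swap) (simp add: case_prod_beta sum_distrib_right)
    also have "\<dots> = (\<Sum>n<Suc m. wsum A (a n) p)"
      by (rule sum.mono_neutral_right) (use zero in \<open>auto simp: L_def\<close>)
    also have "\<dots> = (\<Sum>n<m. wsum ({1..<N (Suc n)} \<times> {1..<N (Suc n)}) (a n) p) + wsum A (a m) p"
      using full by simp
    finally show ?thesis .
  qed
  with le show ?thesis by blast
qed

section \<open>Bumps on dyadic squares\<close>

definition bump2 :: "real \<Rightarrow> nat \<Rightarrow> nat \<Rightarrow> nat \<Rightarrow> real \<Rightarrow> real \<Rightarrow> nat \<Rightarrow> nat \<Rightarrow> real" where
  "bump2 \<gamma> t d s u w k l = \<gamma> * bump_coeff t d s u k * bump_coeff t d s w l"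

lemma bump2_support:
  assumes "bump2 \<gamma> t d s u w k l \<noteq> 0"
  shows "k \<in> {2 ^ t..<2 ^ (t + s)} \<and> l \<in> {2 ^ t..<2 ^ (t + s)}"
  using assms bump_coeff_support [of t d s u k] bump_coeff_support [of t d s w l]
  by (auto simp: bump2_def)

lemma abs_bump2_le: "\<bar>bump2 \<gamma> t d s u w k l\<bar> \<le> \<bar>\<gamma>\<bar> / (2 ^ d * 2 ^ d)"
proof -
  have "\<bar>bump2 \<gamma> t d s u w k l\<bar> \<le> \<bar>\<gamma>\<bar> * (1 / 2 ^ d) * (1 / 2 ^ d)"
    unfolding bump2_def abs_mult by (intro mult_mono abs_bump_coeff_le) auto
  then show ?thesis by simp
qed

lemma sum_product_le:
  fixes f g :: "nat \<Rightarrow> real"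
  assumes "finite X" "\<And>k. 0 \<le> f k" "\<And>l. 0 \<le> g l"
    and "\<And>k. M \<le> k \<Longrightarrow> f k = 0" "\<And>l. M \<le> l \<Longrightarrow> g l = 0"
  shows "(\<Sum>(k, l)\<in>X. f k * g l) \<le> (\<Sum>k<M. f k) * (\<Sum>l<M. g l)"
proof -
  have "(\<Sum>(k, l)\<in>X. f k * g l) = (\<Sum>(k, l)\<in>X \<inter> {..<M} \<times> {..<M}. f k * g l)"
    using assms(4,5) by (intro sum.mono_neutral_right \<open>finite X\<close>) (auto, (meson not_less)+)
  also have "\<dots> \<le> (\<Sum>(k, l)\<in>{..<M} \<times> {..<M}. f k * g l)"
    by (rule sum_mono2) (use assms in auto)
  also have "\<dots> = (\<Sum>k<M. f k) * (\<Sum>l<M. g l)"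
    by (simp add: sum_product sum.cartesian_product)
  finally show ?thesis .
qed

text \<open>The coefficients factor, so any finite sum is dominated by a product of two
  one-dimensional sums.\<close>

lemma sum_bump2_powr:
  assumes "d \<le> t" "finite X"
  shows "(\<Sum>(k, l)\<in>X. \<bar>bump2 \<gamma> t d s u w k l\<bar> powr q)
    \<le> \<bar>\<gamma>\<bar> powr q * (2 ^ s * 2 ^ d * (1 / 2 ^ d) powr q)\<^sup>2"
proof -
  let ?f = "\<lambda>u k. \<bar>bump_coeff t d s u k\<bar> powr q"
  have z: "?f u k = 0" if "2 ^ (t + s) \<le> k" for u k
    using bump_coeff_support(2) [of t d s u k] that by (cases "bump_coeff t d s u k = 0") auto
  have "(\<Sum>(k, l)\<in>X. \<bar>bump2 \<gamma> t d s u w k l\<bar> powr q) = \<bar>\<gamma>\<bar> powr q * (\<Sum>(k, l)\<in>X. ?f u k * ?f w l)"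
    by (simp add: bump2_def abs_mult powr_mult sum_distrib_left case_prod_beta mult_ac)
  also have "\<dots> \<le> \<bar>\<gamma>\<bar> powr q * ((\<Sum>k<2 ^ (t + s). ?f u k) * (\<Sum>l<2 ^ (t + s). ?f w l))"
    by (intro mult_left_mono sum_product_le assms z) auto
  also have "\<dots> \<le> \<bar>\<gamma>\<bar> powr q * ((2 ^ s * 2 ^ d * (1 / 2 ^ d) powr q) * (2 ^ s * 2 ^ d * (1 / 2 ^ d) powr q))"
    by (intro mult_left_mono mult_mono sum_bump_coeff_power assms sum_nonneg) auto
  finally show ?thesis
    by (simp add: power2_eq_square)
qed

text \<open>The previous bound at exponent 2. It holds for every finite part of the bump, and the
  factor \<open>1 / 2 ^ d\<close> makes a cut bump harmless.\<close>

lemma sum_bump2_squared: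
  assumes "d \<le> t" "finite X"
  shows "(\<Sum>(k, l)\<in>X. (bump2 \<gamma> t d s u w k l)\<^sup>2) \<le> (\<bar>\<gamma>\<bar> * 2 ^ s / 2 ^ d)\<^sup>2"
proof -
  have "x\<^sup>2 = \<bar>x\<bar> powr 2" for x :: real
    by simp
  then have "(\<Sum>(k, l)\<in>X. (bump2 \<gamma> t d s u w k l)\<^sup>2) = (\<Sum>(k, l)\<in>X. \<bar>bump2 \<gamma> t d s u w k l\<bar> powr 2)"
    by simp
  also have "\<dots> \<le> \<bar>\<gamma>\<bar> powr 2 * (2 ^ s * 2 ^ d * (1 / 2 ^ d) powr 2)\<^sup>2"
    by (rule sum_bump2_powr [OF assms])
  also have "\<dots> = (\<bar>\<gamma>\<bar> * 2 ^ s / 2 ^ d)\<^sup>2"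
    by (simp add: power2_eq_square field_simps)
  finally show ?thesis .
qed

lemma wsum_bump2:
  assumes "d \<le> t"
  shows "wsum ({1..<2 ^ (t + s)} \<times> {1..<2 ^ (t + s)}) (bump2 \<gamma> t d s u w) p = \<gamma> *
    (if cell d (fst p) = cell d u then if cell s (2 ^ t * fst p) = 0 then 1 - 2 ^ s else 1 else 0) *
    (if cell d (snd p) = cell d w then if cell s (2 ^ t * snd p) = 0 then 1 - 2 ^ s else 1 else 0)"
proof -
  \<comment> \<open>Partial sums start at index 1 whereas \<open>bump_poly\<close> starts at 0; the
    support condition removes the difference.\<close>
  have "bump_coeff t d s u 0 = 0" for u
    using bump_coeff_support(1) [of t d s u 0] by auto
  then have from1: "(\<Sum>k\<in>{1..<2 ^ (t + s)}. bump_coeff t d s u k * walsh k x)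
      = (\<Sum>k<2 ^ (t + s). bump_coeff t d s u k * walsh k x)" for u x
    by (intro sum.mono_neutral_left) (auto simp: Suc_le_eq)
  have "wsum ({1..<2 ^ (t + s)} \<times> {1..<2 ^ (t + s)}) (bump2 \<gamma> t d s u w) p
      = \<gamma> * (\<Sum>k\<in>{1..<2 ^ (t + s)}. bump_coeff t d s u k * walsh k (fst p))
          * (\<Sum>l\<in>{1..<2 ^ (t + s)}. bump_coeff t d s w l * walsh l (snd p))"
    unfolding wsum_def bump2_def sum.cartesian_product [symmetric]
    by (simp add: sum_product sum_distrib_left mult_ac)
  then show ?thesis
    unfolding from1 bump_poly [OF assms] .
qed

lemma emeasure_square_rectangle:
  assumes [measurable]: "X \<in> sets borel" "Y \<in> sets borel"
  shows "emeasure lborel ({p. fst p \<in> X \<and> snd p \<in> Y} \<inter> unit_square)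
    = ennreal ((LBINT x:{0..<1}. of_bool (x \<in> X)) * (LBINT y:{0..<1}. of_bool (y \<in> Y)))"
proof -
  have sets: "{p. fst p \<in> X \<and> snd p \<in> Y} \<in> sets borel"
    using pair_measureI [OF assms] unfolding borel_prod
    by (rule back_subst [where P = "\<lambda>S. S \<in> sets borel"]) auto
  have 1: "emeasure lborel ({p. fst p \<in> X \<and> snd p \<in> Y} \<inter> unit_square) < \<infinity>"
    using emeasure_mono [of "{p. fst p \<in> X \<and> snd p \<in> Y} \<inter> unit_square" unit_square lborel] emeasure_unit_square
    by (auto simp: less_top [symmetric] top_unique)
  have "(LBINT p:unit_square. of_bool (fst p \<in> X) * of_bool (snd p \<in> Y))
      = measure lborel ({p. fst p \<in> X \<and> snd p \<in> Y} \<inter> unit_square)"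
  proof -
    have "(LBINT p:unit_square. of_bool (fst p \<in> X) * of_bool (snd p \<in> Y))
        = (LBINT p. indicator ({p. fst p \<in> X \<and> snd p \<in> Y} \<inter> unit_square) p :: real)"
      unfolding set_lebesgue_integral_def
      by (rule Bochner_Integration.integral_cong) (auto simp: indicator_def)
    then show ?thesis by simp
  qed
  moreover have "(LBINT p:unit_square. of_bool (fst p \<in> X) * of_bool (snd p \<in> Y))
      = (LBINT x:{0..<1}. of_bool (x \<in> X)) * (LBINT y:{0..<1}. of_bool (y \<in> Y) :: real)"
    by (rule square_integral_product [where A = 1 and B = 1]) auto
  ultimately show ?thesis
    using 1 by (simp add: emeasure_eq_ennreal_measure)
qed

text \<open>Outside this set the bump equals \<open>\<gamma>\<close> on its dyadic square and 0 off
  the square.\<close>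

definition bad_cell :: "nat \<Rightarrow> nat \<Rightarrow> nat \<Rightarrow> real \<Rightarrow> real \<Rightarrow> (real \<times> real) set" where
  "bad_cell t d s u w = {p. cell d (fst p) = cell d u \<and> cell d (snd p) = cell d w \<and>
     (cell s (2 ^ t * fst p) = 0 \<or> cell s (2 ^ t * snd p) = 0)}"

lemma bad_cell_measure:
  assumes "d \<le> t"
  shows "bad_cell t d s u w \<in> sets borel"
    and "emeasure lborel (bad_cell t d s u w \<inter> unit_square) \<le> ennreal (2 / (2 ^ d * 2 ^ d * 2 ^ s))"
proof -
  \<comment> \<open>For \<open>r = 0\<close> the second condition always holds, so
    \<open>X 0 u\<close> is the full dyadic interval. The bad set is then a union of two product
    sets, each of measure \<open>1 / (2 ^ d * 2 ^ d * 2 ^ s)\<close> in the square.\<close>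
  define X where "X r u = {x. cell d x = cell d u \<and> cell r (2 ^ t * x) = 0}" for r u
  have X [measurable]: "X r u \<in> sets borel" for r u
  proof -
    have "{x \<in> space borel. cell d x = cell d u \<and> cell r (2 ^ t * x) = 0} \<in> sets borel" by measurable
    then show ?thesis by (simp add: X_def)
  qed
  have eq: "bad_cell t d s u w = {p. fst p \<in> X s u \<and> snd p \<in> X 0 w} \<union> {p. fst p \<in> X 0 u \<and> snd p \<in> X s w}"
    by (auto simp: bad_cell_def X_def)
  have sets: "{p. fst p \<in> X r u \<and> snd p \<in> X r' w} \<in> sets borel" for r r' u w
    using pair_measureI [OF X X] unfolding borel_prod
    by (rule back_subst [where P = "\<lambda>S. S \<in> sets borel"]) auto
  show "bad_cell t d s u w \<in> sets borel"
    unfolding eq using sets by auto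
  have int: "(LBINT x:{0..<1}. of_bool (x \<in> X r u)) = (1 / (2 ^ d * 2 ^ r) :: real)" for r u
    unfolding X_def mem_Collect_eq by (rule unit_integral_bad_cell [OF assms])
  have m: "emeasure lborel ({p. fst p \<in> X r u \<and> snd p \<in> X r' w} \<inter> unit_square)
      = ennreal (1 / (2 ^ d * 2 ^ r) * (1 / (2 ^ d * 2 ^ r')))" for r r' u w
    by (simp only: emeasure_square_rectangle [OF X X] int)
  have "emeasure lborel (bad_cell t d s u w \<inter> unit_square)
      \<le> emeasure lborel ({p. fst p \<in> X s u \<and> snd p \<in> X 0 w} \<inter> unit_square)
        + emeasure lborel ({p. fst p \<in> X 0 u \<and> snd p \<in> X s w} \<inter> unit_square)"
    unfolding eq Int_Un_distrib2 using sets by (intro emeasure_subadditive) auto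
  also have "\<dots> = ennreal (2 / (2 ^ d * 2 ^ d * 2 ^ s))"
    unfolding m by (subst ennreal_plus [symmetric]) (auto simp: field_simps)
  finally show "emeasure lborel (bad_cell t d s u w \<inter> unit_square) \<le> ennreal (2 / (2 ^ d * 2 ^ d * 2 ^ s))" .
qed

section \<open>Approximating a step function by one block\<close>

definition step :: "nat \<Rightarrow> (nat \<Rightarrow> nat \<Rightarrow> real) \<Rightarrow> real \<times> real \<Rightarrow> real" where
  "step d v p = v (cell d (fst p)) (cell d (snd p))"

lemma abs_step_le: "\<bar>step d v p\<bar> \<le> (\<Sum>i<2 ^ d. \<Sum>j<2 ^ d. \<bar>v i j\<bar>)"
proof -
  have "\<bar>step d v p\<bar> \<le> (\<Sum>j<2 ^ d. \<bar>v (cell d (fst p)) j\<bar>)"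
    unfolding step_def by (rule member_le_sum) (auto simp: cell_less)
  also have "\<dots> \<le> (\<Sum>i<2 ^ d. \<Sum>j<2 ^ d. \<bar>v i j\<bar>)"
    by (rule member_le_sum [where f = "\<lambda>i. \<Sum>j<2 ^ d. \<bar>v i j\<bar>"]) (auto simp: cell_less intro: sum_nonneg)
  finally show ?thesis .
qed

lemma step_measurable [measurable]: "step d v \<in> borel_measurable borel"
proof -
  have 1: "(\<lambda>p::real \<times> real. cell d (fst p)) \<in> borel \<rightarrow>\<^sub>M count_space UNIV"
    by (rule measurable_compose [OF _ cell_measurable]) (simp add: borel_prod [symmetric])
  have 2: "(\<lambda>p::real \<times> real. cell d (snd p)) \<in> borel \<rightarrow>\<^sub>M count_space UNIV"
    by (rule measurable_compose [OF _ cell_measurable]) (simp add: borel_prod [symmetric])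
  have "(\<lambda>p::real \<times> real. v i (cell d (snd p))) \<in> borel_measurable borel" for i
    by (rule measurable_compose [OF 2]) simp
  from measurable_compose_countable [OF this 1] show ?thesis
    unfolding step_def [abs_def] .
qed

text \<open>The total \<open>(2 + \<epsilon>)\<close>-th power of the coefficients of the \<open>4\<^sup>d\<close> bumps is \<open>O(4\<^sup>-\<^sup>d\<^sup>\<epsilon>)\<close>; this is
  where the exponents \<open>q > 2\<close> come from.\<close>

lemma eventually_level:
  fixes G C \<epsilon> :: real
  assumes "0 < \<epsilon>"
  shows "\<forall>\<^sub>F d in sequentially. G * C / 2 ^ d \<le> \<epsilon> \<and> G / (2 ^ d * 2 ^ d) \<le> 1 \<and>
    2 ^ d * 2 ^ d * (G powr (2 + \<epsilon>) * (C * 2 ^ d * (1 / 2 ^ d) powr (2 + \<epsilon>))\<^sup>2) \<le> \<epsilon>"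
proof -
  \<comment> \<open>The three conditions are treated as limits in a real variable \<open>X\<close>
    and then transferred along \<open>X = 2 ^ d\<close>.\<close>
  have p: "filterlim (\<lambda>d. 2 ^ d :: real) at_top sequentially"
    by (rule filterlim_at_infinity_imp_filterlim_at_top [OF filterlim_realpow_sequentially_gt1]) auto
  have 1: "((\<lambda>X. G * C / X) \<longlongrightarrow> 0) at_top"
    by (rule tendsto_divide_0 [OF tendsto_const filterlim_at_top_imp_at_infinity [OF filterlim_ident]])
  have 2: "((\<lambda>X. G / (X * X)) \<longlongrightarrow> 0) at_top"
    by (rule tendsto_divide_0 [OF tendsto_const filterlim_at_top_imp_at_infinity
          [OF filterlim_at_top_mult_at_top [OF filterlim_ident filterlim_ident]]])
  have 3: "((\<lambda>X. X * X * (G powr (2 + \<epsilon>) * (C * X * (1 / X) powr (2 + \<epsilon>))\<^sup>2)) \<longlongrightarrow> 0) at_top"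
  proof (rule Lim_transform_eventually)
    have "((\<lambda>X. G powr (2 + \<epsilon>) * C\<^sup>2 * X powr (- (2 * \<epsilon>))) \<longlongrightarrow> G powr (2 + \<epsilon>) * C\<^sup>2 * 0) at_top"
      by (intro tendsto_mult tendsto_const tendsto_neg_powr filterlim_ident) (use assms in simp)
    then show "((\<lambda>X. G powr (2 + \<epsilon>) * C\<^sup>2 * X powr (- (2 * \<epsilon>))) \<longlongrightarrow> 0) at_top"
      by simp
    show "\<forall>\<^sub>F X in at_top. G powr (2 + \<epsilon>) * C\<^sup>2 * X powr (- (2 * \<epsilon>))
        = X * X * (G powr (2 + \<epsilon>) * (C * X * (1 / X) powr (2 + \<epsilon>))\<^sup>2)"
      using eventually_gt_at_top [of 0]
    proof eventually_elim
      case (elim X)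
      have a: "(1 / X) powr (2 + \<epsilon>) = X powr (- \<epsilon>) / (X * X)"
      proof -
        have "(1 / X) powr (2 + \<epsilon>) = X powr (- (2 + \<epsilon>))"
          using elim by (simp add: powr_divide powr_minus_divide del: minus_add_distrib)
        also have "\<dots> = X powr (- \<epsilon>) * X powr (- 2)"
          by (simp add: add.commute flip: powr_add)
        also have "X powr (- 2) = 1 / (X * X)"
          using elim by (simp add: powr_minus divide_inverse power2_eq_square)
        finally show ?thesis by simp
      qed
      have b: "X powr (- (2 * \<epsilon>)) = X powr (- \<epsilon>) * X powr (- \<epsilon>)"
        by (simp flip: powr_add)
      show ?case
        unfolding a b using elim by (simp add: power2_eq_square field_simps)
    qed
  qed
  have e1: "\<forall>\<^sub>F X in at_top. G * C / X < \<epsilon>"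
    using order_tendstoD(2) [OF 1] assms by blast
  have e2: "\<forall>\<^sub>F X in at_top. G / (X * X) < 1"
    using order_tendstoD(2) [OF 2] by simp
  have e3: "\<forall>\<^sub>F X in at_top. X * X * (G powr (2 + \<epsilon>) * (C * X * (1 / X) powr (2 + \<epsilon>))\<^sup>2) < \<epsilon>"
    using order_tendstoD(2) [OF 3] assms by blast
  have "\<forall>\<^sub>F X in at_top. G * C / X \<le> \<epsilon> \<and> G / (X * X) \<le> 1 \<and>
      X * X * (G powr (2 + \<epsilon>) * (C * X * (1 / X) powr (2 + \<epsilon>))\<^sup>2) \<le> \<epsilon>"
    using e1 e2 e3 by eventually_elim auto
  from filterlim_iff [THEN iffD1, OF p, rule_format, OF this] show ?thesis .
qed

text \<open>A single \<open>\<epsilon>\<close> bounds the excess of the exponent over 2, the power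
  sum, the exceptional set \<open>B\<close> and the error of partial sums. The function
  \<open>H\<close> may depend on \<open>A\<close>: it stands for the bump that \<open>A\<close>
  cuts.\<close>

definition approximating_block ::
    "real \<Rightarrow> (real \<times> real \<Rightarrow> real) \<Rightarrow> nat \<Rightarrow> (nat \<Rightarrow> nat \<Rightarrow> real) \<Rightarrow> nat \<Rightarrow> (real \<times> real) set \<Rightarrow> bool" where
  "approximating_block \<epsilon> F N0 a N1 B \<longleftrightarrow>
    N0 < N1 \<and>
    (\<forall>k l. a k l \<noteq> 0 \<longrightarrow> (k, l) \<in> {N0..<N1} \<times> {N0..<N1}) \<and>
    (\<forall>k l. \<bar>a k l\<bar> \<le> 1) \<and>
    (\<forall>X. finite X \<longrightarrow> (\<Sum>(k, l)\<in>X. \<bar>a k l\<bar> powr (2 + \<epsilon>)) \<le> \<epsilon>) \<and>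
    B \<in> sets borel \<and> emeasure lborel (B \<inter> unit_square) \<le> ennreal \<epsilon> \<and>
    (\<forall>p. p \<notin> B \<longrightarrow> wsum ({1..<N1} \<times> {1..<N1}) a p = F p) \<and>
    (\<forall>A. exhausting A \<longrightarrow> (\<exists>H\<in>borel_measurable borel.
       (\<integral>\<^sup>+ p. ennreal \<bar>H p\<bar> \<partial>lebesgue_on unit_square) \<le> ennreal \<epsilon> \<and>
       (\<forall>p. p \<notin> B \<longrightarrow> \<bar>wsum A a p\<bar> \<le> \<bar>F p\<bar> + \<bar>H p\<bar>)))"

text \<open>The order of choices matters: \<open>s\<close> is fixed first, by the measure of the
  exceptional set; then \<open>d\<close> is taken large depending on \<open>s\<close>, which makes
  the cut bumps and the coefficients small; the shifts \<open>t b\<close> come last.\<close>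

lemma approximating_block_exists:
  fixes v :: "nat \<Rightarrow> nat \<Rightarrow> real" and \<epsilon> :: real
  assumes \<epsilon>: "0 < \<epsilon>" and N0: "1 \<le> N0"
  shows "\<exists>a N1 B. approximating_block \<epsilon> (step d0 v) N0 a N1 B"
proof -
  define G where "G = (\<Sum>i<2 ^ d0. \<Sum>j<2 ^ d0. \<bar>v i j\<bar>)"
  have G: "\<bar>step d0 v p\<bar> \<le> G" for p
    unfolding G_def by (rule abs_step_le)
  then have "0 \<le> G" using abs_ge_zero order_trans by blast
  have "((\<lambda>s. 2 * (1 / 2) ^ s) \<longlongrightarrow> (2 * 0 :: real)) sequentially"
    by (intro tendsto_mult tendsto_const LIMSEQ_power_zero) simp
  then have "\<forall>\<^sub>F s in sequentially. 2 * (1 / 2) ^ s < \<epsilon>"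
    using order_tendstoD(2) \<epsilon> by fastforce
  then obtain s0 where s0: "\<And>s. s0 \<le> s \<Longrightarrow> 2 * (1 / 2) ^ s < \<epsilon>"
    unfolding eventually_sequentially by blast
  \<comment> \<open>The successor guarantees \<open>0 < s\<close>, which makes \<open>N\<close>
    strictly increasing.\<close>
  define s where "s = Suc s0"
  have s: "2 / 2 ^ s \<le> \<epsilon>" and "0 < s"
    using s0 [of s] by (simp_all add: s_def power_one_over)
  obtain d1 where d1: "\<And>d. d1 \<le> d \<Longrightarrow> G * 2 ^ s / 2 ^ d \<le> \<epsilon> \<and> G / (2 ^ d * 2 ^ d) \<le> 1 \<and>
    2 ^ d * 2 ^ d * (G powr (2 + \<epsilon>) * (2 ^ s * 2 ^ d * (1 / 2 ^ d) powr (2 + \<epsilon>))\<^sup>2) \<le> \<epsilon>"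
    using eventually_level [OF \<epsilon>, of G "2 ^ s"] unfolding eventually_sequentially by blast
  define d where "d = max d0 d1"
  have d0: "d0 \<le> d" and dL: "G * 2 ^ s / 2 ^ d \<le> \<epsilon>" and dS: "G / (2 ^ d * 2 ^ d) \<le> 1"
    and dq: "2 ^ d * 2 ^ d * (G powr (2 + \<epsilon>) * (2 ^ s * 2 ^ d * (1 / 2 ^ d) powr (2 + \<epsilon>))\<^sup>2) \<le> \<epsilon>"
    using d1 [of d] by (auto simp: d_def)
  define K :: nat where "K = 2 ^ d * 2 ^ d"
  \<comment> \<open>The summand \<open>d\<close> gives \<open>d \<le> t b\<close>, the summand
    \<open>N0\<close> puts all frequencies beyond \<open>N0\<close>, and the increment
    \<open>s\<close> lets the block of each square end where the next begins.\<close>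
  define t where "t b = d + N0 + b * s" for b
  have dt: "d \<le> t b" for b by (simp add: t_def)
  have t_Suc: "t (Suc b) = t b + s" for b by (simp add: t_def)
  define N where "N b = (2::nat) ^ t b" for b
  have N: "strict_mono N"
    unfolding strict_mono_Suc_iff N_def using \<open>0 < s\<close> by (simp add: t_Suc)
  have N0': "N0 \<le> N 0"
  proof -
    have "N0 < 2 ^ N0" by (rule less_exp)
    also have "(2::nat) ^ N0 \<le> N 0" unfolding N_def by (rule power_increasing) (auto simp: t_def)
    finally show ?thesis by simp
  qed
  \<comment> \<open>Square number \<open>b\<close> has column \<open>b div 2 ^ d\<close> and row
    \<open>b mod 2 ^ d\<close>; \<open>u b\<close> and \<open>w b\<close> are the coordinates of its
    lower left corner.\<close>
  define u where "u b = real (b div 2 ^ d) / 2 ^ d" for b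
  define w where "w b = real (b mod 2 ^ d) / 2 ^ d" for b
  have cu: "cell d (u b) = b div 2 ^ d" if "b < K" for b
    unfolding u_def using that by (intro cell_corner) (simp add: K_def less_mult_imp_div_less)
  have cw: "cell d (w b) = b mod 2 ^ d" for b
    unfolding w_def by (intro cell_corner) simp
  define \<gamma> where "\<gamma> b = step d0 v (u b, w b)" for b
  have \<gamma>: "\<bar>\<gamma> b\<bar> \<le> G" for b unfolding \<gamma>_def by (rule G)
  \<comment> \<open>\<open>wsum_glue\<close> expects an infinite sequence of blocks, so the list is
    continued by zero blocks beyond the \<open>K\<close> squares.\<close>
  define e where "e b = (if b < K then bump2 (\<gamma> b) (t b) d s (u b) (w b) else (\<lambda>_ _. 0))" for b
  define a where "a = glue e"
  define B where "B = (\<Union>b<K. bad_cell (t b) d s (u b) (w b))"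
  have e_supp: "k \<in> {N b..<N (Suc b)} \<and> l \<in> {N b..<N (Suc b)}" "b < K" if "e b k l \<noteq> 0" for b k l
    using that bump2_support [of "\<gamma> b" "t b" d s "u b" "w b" k l]
    by (auto simp: e_def N_def t_Suc split: if_splits)
  have a_eq: "a k l = e b k l" if "e b k l \<noteq> 0" for b k l
    unfolding a_def by (rule glue_block [OF N]) (use e_supp that in blast)+
  have a_nz: "\<exists>b. e b k l \<noteq> 0" if "a k l \<noteq> 0" for k l
    using that glue_nonzero unfolding a_def by metis
  have Ng: "1 \<le> N 0" using N0 N0' by simp

  \<comment> \<open>The number of the dyadic square that contains \<open>p\<close>.\<close>
  define c where "c p = cell d (fst p) * 2 ^ d + cell d (snd p)" for p :: "real \<times> real"
  have cK: "c p < K" for p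
  proof -
    have "c p < cell d (fst p) * 2 ^ d + 2 ^ d" by (simp add: c_def cell_less)
    also have "\<dots> = Suc (cell d (fst p)) * 2 ^ d" by simp
    also have "\<dots> \<le> K" unfolding K_def by (intro mult_le_mono) (simp_all add: Suc_le_eq cell_less)
    finally show ?thesis .
  qed
  have c_iff: "b = c p \<longleftrightarrow> cell d (fst p) = b div 2 ^ d \<and> cell d (snd p) = b mod 2 ^ d" for b p
    unfolding c_def using cell_less [of d "snd p"] div_mult_mod_eq [of b "2 ^ d"]
    by (metis div_mult_self3 div_less mod_less mod_mult_self3 add_0 add.commute power_not_zero zero_neq_numeral)
  have full: "wsum ({1..<N (Suc b)} \<times> {1..<N (Suc b)}) (e b) p = (if b = c p then step d0 v p else 0)"
    if "p \<notin> B" for b p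
  proof (cases "b < K")
    case False
    then have "b \<noteq> c p" using cK [of p] by auto
    with False show ?thesis by (simp add: e_def wsum_def)
  next
    case True
    have "p \<notin> bad_cell (t b) d s (u b) (w b)"
      using that True by (auto simp: B_def)
    moreover have "\<gamma> b = step d0 v p" if "cell d (fst p) = cell d (u b)" "cell d (snd p) = cell d (w b)"
      using that [THEN cell_eq_mono, OF d0] by (simp add: \<gamma>_def step_def)
    moreover have "wsum ({1..<N (Suc b)} \<times> {1..<N (Suc b)}) (e b) p = \<gamma> b *
        (if cell d (fst p) = cell d (u b) then if cell s (2 ^ t b * fst p) = 0 then 1 - 2 ^ s else 1 else 0) *
        (if cell d (snd p) = cell d (w b) then if cell s (2 ^ t b * snd p) = 0 then 1 - 2 ^ s else 1 else 0)"
      unfolding N_def t_Suc e_def if_P [OF True] by (rule wsum_bump2 [OF dt])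
    moreover have "b = c p \<longleftrightarrow> cell d (fst p) = cell d (u b) \<and> cell d (snd p) = cell d (w b)"
      unfolding cu [OF True] cw by (rule c_iff)
    ultimately show ?thesis
      by (auto simp: bad_cell_def)
  qed
  \<comment> \<open>Off \<open>B\<close>, complete bumps have disjoint supports, so their sum is the
    step function on the squares already passed and 0 elsewhere. It never exceeds the step function
    in absolute value.\<close>
  have fsum: "(\<Sum>b<m. wsum ({1..<N (Suc b)} \<times> {1..<N (Suc b)}) (e b) p)
      = (if c p < m then step d0 v p else 0)" if "p \<notin> B" for m p
    unfolding full [OF that] by simp

  have "approximating_block \<epsilon> (step d0 v) N0 a (N K) B"
    unfolding approximating_block_def
  proof (intro conjI allI impI)
    have "N 0 < N K"
      using N by (rule strict_monoD) (simp add: K_def)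
    with N0' show "N0 < N K" by simp
    show "(k, l) \<in> {N0..<N K} \<times> {N0..<N K}" if nz: "a k l \<noteq> 0" for k l
    proof -
      obtain b where b: "e b k l \<noteq> 0" using a_nz [OF nz] by blast
      have "N 0 \<le> N b" "N (Suc b) \<le> N K"
        using N e_supp(2) [OF b] by (simp_all add: strict_mono_less_eq Suc_le_eq)
      with e_supp(1) [OF b] N0' show ?thesis by auto
    qed
    show "\<bar>a k l\<bar> \<le> 1" for k l
    proof (cases "a k l = 0")
      case False
      then obtain b where b: "e b k l \<noteq> 0" using a_nz by blast
      have "\<bar>a k l\<bar> \<le> \<bar>\<gamma> b\<bar> / (2 ^ d * 2 ^ d)"
        using a_eq [OF b] e_supp(2) [OF b] abs_bump2_le [of "\<gamma> b" "t b" d s "u b" "w b" k l]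
        by (simp add: e_def)
      also have "\<dots> \<le> G / (2 ^ d * 2 ^ d)"
        by (intro divide_right_mono \<gamma>) simp
      also note dS
      finally show ?thesis .
    qed simp
    show "(\<Sum>(k, l)\<in>X. \<bar>a k l\<bar> powr (2 + \<epsilon>)) \<le> \<epsilon>" if X: "finite X" for X
    proof -
      \<comment> \<open>At every index at most one bump contributes, hence powers can be summed bump
        by bump.\<close>
      have le: "\<bar>a k l\<bar> powr (2 + \<epsilon>) \<le> (\<Sum>b<K. \<bar>e b k l\<bar> powr (2 + \<epsilon>))" for k l
      proof (cases "a k l = 0")
        case True then show ?thesis by (simp add: sum_nonneg)
      next
        case False
        then obtain b where b: "e b k l \<noteq> 0" using a_nz by blast
        show ?thesis
          unfolding a_eq [OF b]
          by (rule member_le_sum [where f = "\<lambda>b. \<bar>e b k l\<bar> powr (2 + \<epsilon>)"]) (use e_supp(2) [OF b] in auto)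
      qed
      have "(\<Sum>(k, l)\<in>X. \<bar>a k l\<bar> powr (2 + \<epsilon>)) \<le> (\<Sum>(k, l)\<in>X. \<Sum>b<K. \<bar>e b k l\<bar> powr (2 + \<epsilon>))"
        by (intro sum_mono) (auto simp: le)
      also have "\<dots> = (\<Sum>b<K. \<Sum>(k, l)\<in>X. \<bar>e b k l\<bar> powr (2 + \<epsilon>))"
        by (simp add: case_prod_beta) (rule sum.swap)
      also have "\<dots> \<le> (\<Sum>b<K. G powr (2 + \<epsilon>) * (2 ^ s * 2 ^ d * (1 / 2 ^ d) powr (2 + \<epsilon>))\<^sup>2)"
      proof (rule sum_mono)
        fix b assume "b \<in> {..<K}"
        then have "(\<Sum>(k, l)\<in>X. \<bar>e b k l\<bar> powr (2 + \<epsilon>))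
            \<le> \<bar>\<gamma> b\<bar> powr (2 + \<epsilon>) * (2 ^ s * 2 ^ d * (1 / 2 ^ d) powr (2 + \<epsilon>))\<^sup>2"
          using sum_bump2_powr [OF dt X, of "\<gamma> b" b s "u b" "w b" "2 + \<epsilon>"] by (simp add: e_def)
        also have "\<dots> \<le> G powr (2 + \<epsilon>) * (2 ^ s * 2 ^ d * (1 / 2 ^ d) powr (2 + \<epsilon>))\<^sup>2"
          using \<epsilon> by (intro mult_right_mono powr_mono2 \<gamma>) auto
        finally show "(\<Sum>(k, l)\<in>X. \<bar>e b k l\<bar> powr (2 + \<epsilon>))
            \<le> G powr (2 + \<epsilon>) * (2 ^ s * 2 ^ d * (1 / 2 ^ d) powr (2 + \<epsilon>))\<^sup>2" .
      qed
      also have "\<dots> \<le> \<epsilon>"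
        using dq by (simp add: K_def)
      finally show ?thesis .
    qed
    show B: "B \<in> sets borel"
      unfolding B_def using bad_cell_measure(1) [OF dt] by auto
    show "emeasure lborel (B \<inter> unit_square) \<le> ennreal \<epsilon>"
    proof -
      have "emeasure lborel (B \<inter> unit_square)
          \<le> (\<Sum>b<K. emeasure lborel (bad_cell (t b) d s (u b) (w b) \<inter> unit_square))"
        unfolding B_def UN_extend_simps
        by (rule emeasure_subadditive_finite) (auto intro!: sets.Int bad_cell_measure(1) [OF dt])
      also have "\<dots> \<le> (\<Sum>b<K. ennreal (2 / (2 ^ d * 2 ^ d * 2 ^ s)))"
        by (intro sum_mono bad_cell_measure(2) [OF dt])
      also have "\<dots> = ennreal (real K * (2 / (2 ^ d * 2 ^ d * 2 ^ s)))"
        by (subst sum_ennreal) simp_all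
      also have "real K * (2 / (2 ^ d * 2 ^ d * 2 ^ s)) = 2 / 2 ^ s"
        by (simp add: K_def)
      also have "ennreal (2 / 2 ^ s) \<le> ennreal \<epsilon>"
        by (rule ennreal_leI [OF s])
      finally show ?thesis .
    qed
    show "wsum ({1..<N K} \<times> {1..<N K}) a p = step d0 v p" if p: "p \<notin> B" for p
    proof -
      obtain m where m: "\<And>p. wsum ({1..<N K} \<times> {1..<N K}) a p
          = (\<Sum>n<m. wsum ({1..<N (Suc n)} \<times> {1..<N (Suc n)}) (e n) p) + wsum ({1..<N K} \<times> {1..<N K}) (e m) p"
        and mK: "\<And>M. {1..<N M} \<times> {1..<N M} \<subseteq> {1..<N K} \<times> {1..<N K} \<Longrightarrow> M \<le> m"
        using wsum_glue [where a = e, OF N e_supp(1) Ng exhausting_square [of "N K"]]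
        unfolding a_def by blast
      \<comment> \<open>All \<open>K\<close> bumps are complete, and the leftover block
        \<open>e m\<close> is one of the zero blocks.\<close>
      have "K \<le> m" by (rule mK) simp
      moreover have "c p < m" using cK [of p] \<open>K \<le> m\<close> by simp
      ultimately show ?thesis
        unfolding m fsum [OF p] by (simp add: e_def wsum_def)
    qed
    show "\<exists>H\<in>borel_measurable borel.
       (\<integral>\<^sup>+ p. ennreal \<bar>H p\<bar> \<partial>lebesgue_on unit_square) \<le> ennreal \<epsilon> \<and>
       (\<forall>p. p \<notin> B \<longrightarrow> \<bar>wsum A a p\<bar> \<le> \<bar>step d0 v p\<bar> + \<bar>H p\<bar>)" if A: "exhausting A" for A
    proof -
      obtain m where m: "\<And>p. wsum A a p
          = (\<Sum>n<m. wsum ({1..<N (Suc n)} \<times> {1..<N (Suc n)}) (e n) p) + wsum A (e m) p"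
        using wsum_glue [where a = e, OF N e_supp(1) Ng A] unfolding a_def by blast
      have fin: "finite A" using A by (simp add: exhausting_def)
      show ?thesis
      proof (intro bexI [of _ "wsum A (e m)"] conjI allI impI)
        have "(\<Sum>(k, l)\<in>A. (e m k l)\<^sup>2) \<le> \<epsilon>\<^sup>2"
        proof (cases "m < K")
          case True
          then have "(\<Sum>(k, l)\<in>A. (e m k l)\<^sup>2) \<le> (\<bar>\<gamma> m\<bar> * 2 ^ s / 2 ^ d)\<^sup>2"
            using sum_bump2_squared [OF dt fin, of "\<gamma> m" m s "u m" "w m"] by (simp add: e_def)
          also have "\<bar>\<gamma> m\<bar> * 2 ^ s / 2 ^ d \<le> G * 2 ^ s / 2 ^ d"
            by (intro divide_right_mono mult_right_mono \<gamma>) auto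
          with dL have "(\<bar>\<gamma> m\<bar> * 2 ^ s / 2 ^ d)\<^sup>2 \<le> \<epsilon>\<^sup>2"
            by (intro power_mono) auto
          finally show ?thesis .
        qed (simp add: e_def)
        then show "(\<integral>\<^sup>+ p. ennreal \<bar>wsum A (e m) p\<bar> \<partial>lebesgue_on unit_square) \<le> ennreal \<epsilon>"
          by (rule wsum_L1_bound [OF fin \<epsilon>])
        show "\<bar>wsum A a p\<bar> \<le> \<bar>step d0 v p\<bar> + \<bar>wsum A (e m) p\<bar>" if p: "p \<notin> B" for p
          unfolding m fsum [OF p] by auto
      qed measurable
    qed
  qed
  then show ?thesis by blast
qed

section \<open>Weighted norms and density of step functions\<close>

lemma AE_unit_square:
  assumes "AE p in lborel. P p"
  shows "AE p in lebesgue_on unit_square. P p"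
  using AE_completion [OF assms] by (subst AE_restrict_space_iff) auto

locale weight =
  fixes \<mu> :: "real \<times> real \<Rightarrow> real"
  assumes \<mu>_measurable [measurable]: "\<mu> \<in> borel_measurable (lebesgue_on unit_square)"
    and \<mu>_pos: "\<And>p. p \<in> unit_square \<Longrightarrow> 0 < \<mu> p"
    and \<mu>_le_1: "\<And>p. p \<in> unit_square \<Longrightarrow> \<mu> p \<le> 1"
begin

lemma weighted_norm_le:
  assumes [measurable]: "f \<in> borel_measurable (lebesgue_on unit_square)"
  shows "weighted_norm \<mu> f \<le> (\<integral>\<^sup>+ p. ennreal \<bar>f p\<bar> \<partial>lebesgue_on unit_square)"
  unfolding weighted_norm_def
  by (intro nn_integral_mono ennreal_leI) (auto intro: mult_left_le \<mu>_le_1)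

lemma weighted_norm_const: "weighted_norm \<mu> (\<lambda>_. c) \<le> ennreal \<bar>c\<bar>"
proof -
  have "weighted_norm \<mu> (\<lambda>_. c) \<le> (\<integral>\<^sup>+ p. ennreal \<bar>c\<bar> \<partial>lebesgue_on unit_square)"
    by (rule weighted_norm_le) simp
  also have "\<dots> = ennreal \<bar>c\<bar>"
    using emeasure_unit_square by (simp add: emeasure_restrict_space)
  finally show ?thesis .
qed

lemma weighted_norm_add:
  assumes [measurable]: "f \<in> borel_measurable (lebesgue_on unit_square)" "g \<in> borel_measurable (lebesgue_on unit_square)"
  shows "weighted_norm \<mu> (\<lambda>p. f p + g p) \<le> weighted_norm \<mu> f + weighted_norm \<mu> g"
proof -
  have "weighted_norm \<mu> (\<lambda>p. f p + g p)
      \<le> (\<integral>\<^sup>+ p. ennreal (\<bar>f p\<bar> * \<mu> p) + ennreal (\<bar>g p\<bar> * \<mu> p) \<partial>lebesgue_on unit_square)"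
    unfolding weighted_norm_def
  proof (rule nn_integral_mono)
    fix p assume "p \<in> space (lebesgue_on unit_square)"
    then have "0 < \<mu> p" by (simp add: \<mu>_pos)
    then have "\<bar>f p + g p\<bar> * \<mu> p \<le> \<bar>f p\<bar> * \<mu> p + \<bar>g p\<bar> * \<mu> p"
      by (metis abs_triangle_ineq distrib_right less_imp_le mult_right_mono)
    then show "ennreal (\<bar>f p + g p\<bar> * \<mu> p) \<le> ennreal (\<bar>f p\<bar> * \<mu> p) + ennreal (\<bar>g p\<bar> * \<mu> p)"
      using \<open>0 < \<mu> p\<close> by (simp flip: ennreal_plus add: ennreal_leI)
  qed
  also have "\<dots> = weighted_norm \<mu> f + weighted_norm \<mu> g"
    unfolding weighted_norm_def by (rule nn_integral_add) measurable
  finally show ?thesis .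
qed

lemma weighted_norm_minus: "weighted_norm \<mu> (\<lambda>p. f p - g p) = weighted_norm \<mu> (\<lambda>p. g p - f p)"
  by (simp add: weighted_norm_def abs_minus_commute)

lemma weighted_norm_diff_triangle:
  assumes [measurable]: "f \<in> borel_measurable (lebesgue_on unit_square)"
    "g \<in> borel_measurable (lebesgue_on unit_square)" "h \<in> borel_measurable (lebesgue_on unit_square)"
  shows "weighted_norm \<mu> (\<lambda>p. f p - h p)
    \<le> weighted_norm \<mu> (\<lambda>p. f p - g p) + weighted_norm \<mu> (\<lambda>p. g p - h p)"
  using weighted_norm_add [of "\<lambda>p. f p - g p" "\<lambda>p. g p - h p"] by simp

text \<open>Dominated convergence in the weighted space, used for each of the three approximations
  in \<open>list_step_dense\<close>.\<close>

lemma weighted_norm_tendsto_0: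
  assumes u [measurable]: "\<And>n. u n \<in> borel_measurable (lebesgue_on unit_square)"
    and w [measurable]: "w \<in> borel_measurable (lebesgue_on unit_square)"
    and fin: "weighted_norm \<mu> w < \<infinity>"
    and bound: "\<And>n p. p \<in> unit_square \<Longrightarrow> \<bar>u n p\<bar> \<le> \<bar>w p\<bar>"
    and lim: "AE p in lebesgue_on unit_square. (\<lambda>n. u n p) \<longlonglongrightarrow> 0"
  shows "(\<lambda>n. weighted_norm \<mu> (u n)) \<longlonglongrightarrow> 0"
proof -
  have "(\<lambda>n. \<integral>\<^sup>+ p. ennreal (\<bar>u n p\<bar> * \<mu> p) \<partial>lebesgue_on unit_square)
      \<longlonglongrightarrow> (\<integral>\<^sup>+ p. 0 \<partial>lebesgue_on unit_square)"
  proof (rule nn_integral_dominated_convergence [where w = "\<lambda>p. ennreal (\<bar>w p\<bar> * \<mu> p)"])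
    show "AE p in lebesgue_on unit_square. ennreal (\<bar>u n p\<bar> * \<mu> p) \<le> ennreal (\<bar>w p\<bar> * \<mu> p)" for n
      by (intro AE_I2 ennreal_leI mult_right_mono)
        (auto intro: bound less_imp_le [OF \<mu>_pos])
    show "(\<integral>\<^sup>+ p. ennreal (\<bar>w p\<bar> * \<mu> p) \<partial>lebesgue_on unit_square) < \<infinity>"
      using fin by (simp add: weighted_norm_def)
    show "AE p in lebesgue_on unit_square. (\<lambda>n. ennreal (\<bar>u n p\<bar> * \<mu> p)) \<longlonglongrightarrow> 0"
      using lim
    proof eventually_elim
      case (elim p)
      have "(\<lambda>n. \<bar>u n p\<bar> * \<mu> p) \<longlonglongrightarrow> \<bar>0\<bar> * \<mu> p"
        by (intro tendsto_mult tendsto_const tendsto_rabs elim)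
      then have "(\<lambda>n. ennreal (\<bar>u n p\<bar> * \<mu> p)) \<longlonglongrightarrow> ennreal (\<bar>0\<bar> * \<mu> p)"
        by (rule tendsto_ennrealI)
      then show ?case by simp
    qed
  qed measurable
  then show ?thesis
    by (simp add: weighted_norm_def)
qed

end

section \<open>Density of countably many step functions\<close>

definition clip :: "real \<Rightarrow> real \<Rightarrow> real" where
  "clip C x = max (- C) (min C x)"

lemma abs_clip_le: "0 \<le> C \<Longrightarrow> \<bar>clip C x\<bar> \<le> C"
  by (auto simp: clip_def)

lemma continuous_on_clip: "continuous_on UNIV (clip C)"
  unfolding clip_def [abs_def] by (intro continuous_intros)

lemma clip_measurable [measurable]: "clip C \<in> borel_measurable borel"
  by (rule borel_measurable_continuous_onI [OF continuous_on_clip])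

text \<open>Finite lists of integers make this a countable family. Values are multiples of
  \<open>1 / 2 ^ d\<close>, so that a single limit in \<open>d\<close> refines both the squares and
  the values.\<close>

definition list_step :: "nat \<Rightarrow> int list \<Rightarrow> real \<times> real \<Rightarrow> real" where
  "list_step d L = step d (\<lambda>i j. of_int (L ! (i * 2 ^ d + j)) / 2 ^ d)"

lemma list_step_measurable [measurable]: "list_step d L \<in> borel_measurable borel"
  unfolding list_step_def by measurable

lemma floor_dyadic_tendsto:
  assumes "f \<longlonglongrightarrow> (a :: real)"
  shows "(\<lambda>d. of_int \<lfloor>2 ^ d * f d\<rfloor> / 2 ^ d) \<longlonglongrightarrow> a"
proof -
  have z: "(\<lambda>d. 1 / 2 ^ d :: real) \<longlonglongrightarrow> 0"
    using LIMSEQ_power_zero [of "1 / 2 :: real"] by (simp add: power_one_over)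
  have "(\<lambda>d. f d - of_int \<lfloor>2 ^ d * f d\<rfloor> / 2 ^ d) \<longlonglongrightarrow> 0"
  proof (rule tendsto_sandwich [OF _ _ tendsto_const z])
    show "\<forall>\<^sub>F d in sequentially. 0 \<le> f d - of_int \<lfloor>2 ^ d * f d\<rfloor> / 2 ^ d"
      by (rule always_eventually) (auto simp: field_simps)
    show "\<forall>\<^sub>F d in sequentially. f d - of_int \<lfloor>2 ^ d * f d\<rfloor> / 2 ^ d \<le> 1 / 2 ^ d"
    proof (rule always_eventually, rule allI)
      fix d
      have "2 ^ d * f d - of_int \<lfloor>2 ^ d * f d\<rfloor> \<le> 1" by linarith
      then have "(2 ^ d * f d - of_int \<lfloor>2 ^ d * f d\<rfloor>) / 2 ^ d \<le> 1 / 2 ^ d"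
        by (rule divide_right_mono) simp
      then show "f d - of_int \<lfloor>2 ^ d * f d\<rfloor> / 2 ^ d \<le> 1 / 2 ^ d"
        by (simp add: diff_divide_distrib)
    qed
  qed
  from tendsto_diff [OF assms this] show ?thesis by simp
qed

lemma cell_corner_tendsto:
  assumes "0 \<le> x" "x < 1"
  shows "(\<lambda>d. real (cell d x) / 2 ^ d) \<longlonglongrightarrow> x"
proof -
  have "real (cell d x) = of_int \<lfloor>2 ^ d * x\<rfloor>" for d
  proof -
    have "0 \<le> \<lfloor>2 ^ d * x\<rfloor>" using assms by simp
    moreover have "\<lfloor>2 ^ d * x\<rfloor> < 2 ^ d"
      using assms by (simp add: floor_less_iff)
    ultimately show ?thesis by (simp add: cell_def)
  qed
  then show ?thesis
    using floor_dyadic_tendsto [of "\<lambda>_. x" x] by simp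
qed

text \<open>\<open>cell\<close> wraps the coordinate 1 around to 0, so corners of cells need not
  converge to points on these two edges.\<close>

lemma AE_less_1: "AE p in lebesgue_on unit_square. fst p < 1 \<and> snd p < 1"
proof -
  have "emeasure (lborel \<Otimes>\<^sub>M lborel) ({1::real} \<times> (UNIV :: real set)) = 0"
    "emeasure (lborel \<Otimes>\<^sub>M lborel) ((UNIV :: real set) \<times> {1::real}) = 0"
    by (subst lborel.emeasure_pair_measure_Times; simp)+
  moreover have "{1::real} \<times> (UNIV :: real set) \<in> sets borel" "(UNIV :: real set) \<times> {1::real} \<in> sets borel"
    by (intro borel_closed closed_Times; simp)+
  ultimately have "AE p in lborel. p \<notin> {1::real} \<times> (UNIV :: real set)" "AE p in lborel. p \<notin> (UNIV :: real set) \<times> {1::real}"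
    unfolding lborel_prod by (intro AE_not_in; simp add: null_sets_def)+
  then have "AE p in lebesgue_on unit_square. p \<notin> {1::real} \<times> (UNIV :: real set)"
     "AE p in lebesgue_on unit_square. p \<notin> (UNIV :: real set) \<times> {1::real}"
    by (simp_all add: AE_unit_square)
  moreover have "AE p in lebesgue_on unit_square. p \<in> unit_square"
    by (rule AE_I2) simp
  ultimately show ?thesis
    by eventually_elim (auto simp: unit_square_def)
qed

text \<open>Sample \<open>g\<close> at the lower left corner of each square and round down to a
  multiple of \<open>1 / 2 ^ d\<close>. Rounding costs at most 1, which gives the uniform bound
  needed for dominated convergence.\<close>

lemma list_step_approx:
  fixes g :: "real \<times> real \<Rightarrow> real"
  assumes g: "continuous_on UNIV g" and C: "\<And>p. \<bar>g p\<bar> \<le> C"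
  obtains L where "\<And>d p. \<bar>list_step d (L d) p\<bar> \<le> C + 1"
    "AE p in lebesgue_on unit_square. (\<lambda>d. list_step d (L d) p) \<longlonglongrightarrow> g p"
proof -
  define corner where "corner d p = (real (cell d (fst p)) / 2 ^ d, real (cell d (snd p)) / 2 ^ d)" for d and p :: "real \<times> real"
  define L where "L d = map (\<lambda>k. \<lfloor>2 ^ d * g (real (k div 2 ^ d) / 2 ^ d, real (k mod 2 ^ d) / 2 ^ d)\<rfloor>) [0..<2 ^ d * 2 ^ d]" for d
  have eq: "list_step d (L d) p = of_int \<lfloor>2 ^ d * g (corner d p)\<rfloor> / 2 ^ d" for d p
  proof -
    have "cell d (fst p) * 2 ^ d + cell d (snd p) < Suc (cell d (fst p)) * 2 ^ d"
      by (simp add: cell_less)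
    also have "\<dots> \<le> 2 ^ d * 2 ^ d" by (intro mult_le_mono) (simp_all add: Suc_le_eq cell_less)
    finally show ?thesis
      using cell_less [of d "snd p"] by (simp add: list_step_def step_def L_def corner_def)
  qed
  show thesis
  proof (rule that [of L])
    show "\<bar>list_step d (L d) p\<bar> \<le> C + 1" for d p
    proof -
      have "\<bar>of_int \<lfloor>2 ^ d * g (corner d p)\<rfloor> - 2 ^ d * g (corner d p)\<bar> \<le> 1" by linarith
      then have "\<bar>(of_int \<lfloor>2 ^ d * g (corner d p)\<rfloor> - 2 ^ d * g (corner d p)) / 2 ^ d\<bar> \<le> 1 / 2 ^ d"
        unfolding abs_divide by (simp add: divide_right_mono)
      also have "\<dots> \<le> (1 :: real)" by simp
      also have "(of_int \<lfloor>2 ^ d * g (corner d p)\<rfloor> - 2 ^ d * g (corner d p)) / 2 ^ d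
          = list_step d (L d) p - g (corner d p)"
        by (simp add: eq diff_divide_distrib)
      finally show ?thesis using C [of "corner d p"] by linarith
    qed
    have "AE p in lebesgue_on unit_square. p \<in> unit_square"
      by (rule AE_I2) simp
    then show "AE p in lebesgue_on unit_square. (\<lambda>d. list_step d (L d) p) \<longlonglongrightarrow> g p"
      using AE_less_1
    proof eventually_elim
      case (elim p)
      then have "(\<lambda>d. corner d p) \<longlonglongrightarrow> (fst p, snd p)"
        unfolding corner_def by (intro tendsto_Pair cell_corner_tendsto) (auto simp: unit_square_def)
      then have "(\<lambda>d. corner d p) \<longlonglongrightarrow> p" by simp
      moreover have "isCont g p"
        using g continuous_on_eq_continuous_at by blast
      ultimately have "(\<lambda>d. g (corner d p)) \<longlonglongrightarrow> g p"
        by (rule isCont_tendsto_compose [rotated])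
      then show ?case
        unfolding eq by (rule floor_dyadic_tendsto)
    qed
  qed
qed

context weight
begin

text \<open>Three steps, each within a third of the tolerance: truncation, continuous functions,
  step functions. Truncation comes first so that constants dominate in the other two.\<close>

lemma list_step_dense:
  assumes f: "f \<in> weighted_L1 \<mu>" and \<eta>: "0 < \<eta>"
  obtains d L where "weighted_norm \<mu> (\<lambda>p. f p - list_step d L p) < \<eta>"
proof -
  have f_meas [measurable]: "f \<in> borel_measurable (lebesgue_on unit_square)"
    and f_fin: "weighted_norm \<mu> f < \<infinity>"
    using f by (auto simp: weighted_L1_def)
  \<comment> \<open>The tolerance \<open>\<eta>\<close> may be infinite; a real number below it can
    be divided by 3.\<close>
  obtain \<theta> :: real where \<theta>: "0 < \<theta>" "ennreal \<theta> < \<eta>"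
  proof -
    obtain e where e: "0 < e" "e < \<eta>" using dense [OF \<eta>] by blast
    then obtain \<theta> where "0 \<le> \<theta>" "e = ennreal \<theta>"
      by (cases e) auto
    with e show ?thesis by (intro that [of \<theta>]) (auto simp: order_less_le)
  qed
  have pos: "0 < ennreal (\<theta> / 3)" using \<theta> by simp

  have "(\<lambda>n. weighted_norm \<mu> (\<lambda>p. f p - clip (real n) (f p))) \<longlonglongrightarrow> 0"
  proof (rule weighted_norm_tendsto_0 [OF _ f_meas f_fin])
    show "\<bar>f p - clip (real n) (f p)\<bar> \<le> \<bar>f p\<bar>" for n p
      by (auto simp: clip_def)
    show "AE p in lebesgue_on unit_square. (\<lambda>n. f p - clip (real n) (f p)) \<longlonglongrightarrow> 0"
    proof (rule AE_I2, rule tendsto_eventually)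
      fix p
      obtain n0 where "\<bar>f p\<bar> \<le> real n0" using real_arch_simple by blast
      then show "\<forall>\<^sub>F n in sequentially. f p - clip (real n) (f p) = 0"
        unfolding eventually_sequentially by (intro exI [of _ n0]) (auto simp: clip_def)
    qed
  qed measurable
  then obtain n where n: "weighted_norm \<mu> (\<lambda>p. f p - clip (real n) (f p)) < ennreal (\<theta> / 3)"
    using order_tendstoD(2) [OF _ pos] eventually_happens' sequentially_bot by blast
  define C where "C = real n"
  have C0: "0 \<le> C" by (simp add: C_def)

  \<comment> \<open>This notion of measurability supplies continuous functions converging off a
    negligible set; clipping them keeps continuity and adds a uniform bound.\<close>
  have "f measurable_on unit_square"
    using f_meas by (subst measurable_on_iff_borel_measurable) auto
  then obtain Z g where Z: "negligible Z" and g: "\<And>n. continuous_on UNIV (g n)"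
    and lim: "\<And>p. p \<notin> Z \<Longrightarrow> (\<lambda>n. g n p) \<longlonglongrightarrow> (if p \<in> unit_square then f p else 0)"
    unfolding measurable_on_def by blast
  define h where "h n p = clip C (g n p)" for n p
  have h_cont: "continuous_on UNIV (h n)" for n
    unfolding h_def [abs_def] by (rule continuous_on_compose2 [OF continuous_on_clip g]) simp
  have h_le: "\<bar>h n p\<bar> \<le> C" for n p
    unfolding h_def by (rule abs_clip_le [OF C0])
  have h_meas [measurable]: "h n \<in> borel_measurable borel" for n
    by (rule borel_measurable_continuous_onI [OF h_cont])
  have h_meas' [measurable]: "h n \<in> borel_measurable (lebesgue_on unit_square)" for n
    by (rule borel_imp_lebesgue_on) measurable
  have fin: "weighted_norm \<mu> (\<lambda>_. c) < \<infinity>" for c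
    using weighted_norm_const [of c] ennreal_less_top order_le_less_trans by fastforce
  have "(\<lambda>n. weighted_norm \<mu> (\<lambda>p. clip C (f p) - h n p)) \<longlonglongrightarrow> 0"
  proof (rule weighted_norm_tendsto_0 [OF _ _ fin [of "2 * C"]])
    show "\<bar>clip C (f p) - h n p\<bar> \<le> \<bar>2 * C\<bar>" for n p
      using abs_clip_le [OF C0, of "f p"] h_le [of n p] by linarith
    have "AE p in lebesgue. p \<notin> Z"
      using Z by (intro AE_not_in) (simp add: negligible_iff_null_sets)
    then have "AE p in lebesgue_on unit_square. p \<notin> Z"
      by (subst AE_restrict_space_iff) auto
    moreover have "AE p in lebesgue_on unit_square. p \<in> unit_square"
      by (rule AE_I2) simp
    ultimately show "AE p in lebesgue_on unit_square. (\<lambda>n. clip C (f p) - h n p) \<longlonglongrightarrow> 0"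
    proof eventually_elim
      case (elim p)
      then have "(\<lambda>n. g n p) \<longlonglongrightarrow> f p" using lim [of p] by simp
      moreover have "isCont (clip C) (f p)"
        using continuous_on_clip by (simp add: continuous_on_eq_continuous_at)
      ultimately have "(\<lambda>n. h n p) \<longlonglongrightarrow> clip C (f p)"
        unfolding h_def by (rule isCont_tendsto_compose [rotated])
      from tendsto_diff [OF tendsto_const this, of "clip C (f p)"] show ?case by simp
    qed
  qed measurable
  then obtain m where m: "weighted_norm \<mu> (\<lambda>p. clip C (f p) - h m p) < ennreal (\<theta> / 3)"
    using order_tendstoD(2) [OF _ pos] eventually_happens' sequentially_bot by blast

  obtain L where L_le: "\<And>d p. \<bar>list_step d (L d) p\<bar> \<le> C + 1"
    and L_lim: "AE p in lebesgue_on unit_square. (\<lambda>d. list_step d (L d) p) \<longlonglongrightarrow> h m p"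
    using list_step_approx [OF h_cont h_le, of m] by blast
  have s_meas [measurable]: "list_step d L \<in> borel_measurable (lebesgue_on unit_square)" for d L
    by (rule borel_imp_lebesgue_on) measurable
  have "(\<lambda>d. weighted_norm \<mu> (\<lambda>p. h m p - list_step d (L d) p)) \<longlonglongrightarrow> 0"
  proof (rule weighted_norm_tendsto_0 [OF _ _ fin [of "2 * C + 1"]])
    show "\<bar>h m p - list_step d (L d) p\<bar> \<le> \<bar>2 * C + 1\<bar>" for d p
      using h_le [of m p] L_le [of d p] by linarith
    show "AE p in lebesgue_on unit_square. (\<lambda>d. h m p - list_step d (L d) p) \<longlonglongrightarrow> 0"
      using L_lim
    proof eventually_elim
      case (elim p)
      from tendsto_diff [OF tendsto_const elim, of "h m p"] show ?case by simp
    qed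
  qed measurable
  then obtain d where d: "weighted_norm \<mu> (\<lambda>p. h m p - list_step d (L d) p) < ennreal (\<theta> / 3)"
    using order_tendstoD(2) [OF _ pos] eventually_happens' sequentially_bot by blast

  have "weighted_norm \<mu> (\<lambda>p. clip C (f p) - list_step d (L d) p)
      \<le> weighted_norm \<mu> (\<lambda>p. clip C (f p) - h m p) + weighted_norm \<mu> (\<lambda>p. h m p - list_step d (L d) p)"
    by (rule weighted_norm_diff_triangle) measurable
  also have "\<dots> \<le> ennreal (\<theta> / 3) + ennreal (\<theta> / 3)"
    using m d by (intro add_mono) auto
  finally have md: "weighted_norm \<mu> (\<lambda>p. clip C (f p) - list_step d (L d) p) \<le> ennreal (\<theta> / 3) + ennreal (\<theta> / 3)" .
  have "weighted_norm \<mu> (\<lambda>p. f p - list_step d (L d) p)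
      \<le> weighted_norm \<mu> (\<lambda>p. f p - clip C (f p)) + weighted_norm \<mu> (\<lambda>p. clip C (f p) - list_step d (L d) p)"
    by (rule weighted_norm_diff_triangle) measurable
  also have "\<dots> \<le> ennreal (\<theta> / 3) + (ennreal (\<theta> / 3) + ennreal (\<theta> / 3))"
    using n md by (intro add_mono) (auto simp: C_def)
  also have "\<dots> = ennreal \<theta>"
    using \<theta> by (simp flip: ennreal_plus)
  also note \<theta>(2)
  finally show thesis by (rule that)
qed

end

section \<open>Summability of the coefficients, and the weight\<close>

lemma powr_le_powr_exponent:
  fixes x :: real
  assumes "0 \<le> x" "x \<le> 1" "q \<le> q'"
  shows "x powr q' \<le> x powr q"
  using assms by (cases "x = 0") (auto intro: powr_mono')

text \<open>Once \<open>2 + (1 / 2) ^ n \<le> q\<close>, passing from that exponent to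
  \<open>q\<close> only decreases powers of numbers in \<open>[0, 1]\<close>, so these blocks sum
  like a geometric series. The finitely many earlier blocks have finitely many terms, each at most
  1.\<close>

lemma summable_on_glue:
  assumes N: "strict_mono N"
    and supp: "\<And>n k l. a n k l \<noteq> 0 \<Longrightarrow> k \<in> {N n..<N (Suc n)} \<and> l \<in> {N n..<N (Suc n)}"
    and le1: "\<And>n k l. \<bar>a n k l\<bar> \<le> 1"
    and sums: "\<And>n X. finite X \<Longrightarrow> (\<Sum>(k, l)\<in>X. \<bar>a n k l\<bar> powr (2 + (1 / 2) ^ n)) \<le> (1 / 2) ^ n"
    and q: "(2 :: real) < q"
  shows "(\<lambda>(k, l). \<bar>glue a k l\<bar> powr q) summable_on S"
proof -
  obtain n1 where n1: "(1 / 2) ^ n1 < q - 2"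
    using q real_arch_pow_inv [of "q - 2" "1 / 2"] by auto
  define C where "C n = (if n < n1 then real (N (Suc n) * N (Suc n)) else (1 / 2) ^ n)" for n
  have C0: "0 \<le> C n" for n by (simp add: C_def)
  have block: "(\<Sum>(k, l)\<in>X. \<bar>a n k l\<bar> powr q) \<le> C n" if X: "finite X" for X n
  proof (cases "n < n1")
    case True
    have "(\<Sum>(k, l)\<in>X. \<bar>a n k l\<bar> powr q)
        = (\<Sum>(k, l)\<in>X \<inter> {..<N (Suc n)} \<times> {..<N (Suc n)}. \<bar>a n k l\<bar> powr q)"
      by (rule sum.mono_neutral_right [OF X]) (use supp [of n] in force)+
    also have "\<dots> \<le> (\<Sum>(k, l)\<in>X \<inter> {..<N (Suc n)} \<times> {..<N (Suc n)}. 1)"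
      using q le1 by (intro sum_mono) (auto intro: powr_le1)
    also have "\<dots> \<le> real (card ({..<N (Suc n)} \<times> {..<N (Suc n)}))"
    proof -
      have "card (X \<inter> {..<N (Suc n)} \<times> {..<N (Suc n)}) \<le> card ({..<N (Suc n)} \<times> {..<N (Suc n)})"
        by (rule card_mono) auto
      then show ?thesis
        unfolding case_prod_beta sum_constant of_nat_1 mult_1_right by (rule of_nat_mono)
    qed
    finally show ?thesis using True by (simp add: C_def)
  next
    case False
    then have "(1 / 2 :: real) ^ n \<le> (1 / 2) ^ n1" by (intro power_decreasing) auto
    with n1 have "2 + (1 / 2) ^ n \<le> q" by linarith
    then have "(\<Sum>(k, l)\<in>X. \<bar>a n k l\<bar> powr q) \<le> (\<Sum>(k, l)\<in>X. \<bar>a n k l\<bar> powr (2 + (1 / 2) ^ n))"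
      using le1 by (intro sum_mono) (auto intro: powr_le_powr_exponent)
    also have "\<dots> \<le> (1 / 2) ^ n" by (rule sums [OF X])
    finally show ?thesis using False by (simp add: C_def)
  qed
  have term_le: "\<bar>glue a k l\<bar> powr q \<le> (\<Sum>n<L. \<bar>a n k l\<bar> powr q)" if "k < L" for k l L
  proof (cases "glue a k l = 0")
    case True then show ?thesis by (simp add: sum_nonneg)
  next
    case False
    then obtain n where n: "a n k l \<noteq> 0" by (rule glue_nonzero)
    have eq: "glue a k l = a n k l"
      by (rule glue_block [where a = a, OF N]) (use supp n in blast)+
    have "n \<le> N n" by (rule strict_mono_imp_increasing [OF N])
    then have "n < L" using supp [OF n] that by simp
    then show ?thesis
      unfolding eq by (intro member_le_sum [where f = "\<lambda>n. \<bar>a n k l\<bar> powr q"]) auto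
  qed
  show ?thesis
  proof (rule nonneg_bdd_above_summable_on)
    show "bdd_above (sum (\<lambda>(k, l). \<bar>glue a k l\<bar> powr q) ` {F. F \<subseteq> S \<and> finite F})"
    proof (rule bdd_aboveI2 [where M = "(\<Sum>n<n1. C n) + 2"])
      fix X assume "X \<in> {F. F \<subseteq> S \<and> finite F}"
      then have X: "finite X" by simp
      define L where "L = n1 + Suc (Max (insert 0 (fst ` X)))"
      have L: "k < L" if "(k, l) \<in> X" for k l
      proof -
        have "k \<le> Max (insert 0 (fst ` X))"
          using X that by (intro Max_ge) (auto intro: rev_image_eqI)
        then show ?thesis by (simp add: L_def)
      qed
      have "(\<Sum>(k, l)\<in>X. \<bar>glue a k l\<bar> powr q) \<le> (\<Sum>(k, l)\<in>X. \<Sum>n<L. \<bar>a n k l\<bar> powr q)"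
        by (intro sum_mono) (auto intro: term_le L)
      also have "\<dots> = (\<Sum>n<L. \<Sum>(k, l)\<in>X. \<bar>a n k l\<bar> powr q)"
        by (simp add: case_prod_beta) (rule sum.swap)
      also have "\<dots> \<le> (\<Sum>n<L. C n)"
        by (intro sum_mono block X)
      also have "\<dots> = (\<Sum>n<n1. C n) + (\<Sum>n\<in>{n1..<L}. C n)"
      proof -
        have split: "{..<L} = {..<n1} \<union> {n1..<L}" by (auto simp: L_def)
        show ?thesis unfolding split by (rule sum.union_disjoint) auto
      qed
      also have "(\<Sum>n\<in>{n1..<L}. C n) = (\<Sum>n\<in>{n1..<L}. (1 / 2) ^ n)"
        by (intro sum.cong) (auto simp: C_def)
      also have "\<dots> \<le> (\<Sum>n<L. (1 / 2) ^ n)"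
        by (rule sum_mono2) auto
      also have "\<dots> \<le> 2"
        by (subst geometric_sum) auto
      finally show "(\<Sum>(k, l)\<in>X. \<bar>glue a k l\<bar> powr q) \<le> (\<Sum>n<n1. C n) + 2" by simp
    qed
  qed auto
qed

text \<open>The weight is \<open>1 / (1 + \<Sum>\<^sub>n h\<^sub>n 2\<^sup>n 1\<^sub>B\<^sub>n)\<close>. Almost every point lies in finitely many of the sets
  \<open>B\<^sub>n\<close>; on the remaining null set the sum may be infinite, and \<open>enn2real\<close> turns it into \<open>0\<close>.\<close>

lemma weight_exists:
  fixes B :: "nat \<Rightarrow> (real \<times> real) set" and h :: "nat \<Rightarrow> real" and \<epsilon> :: real
  assumes B [measurable]: "\<And>n. B n \<in> sets borel"
    and Bm: "\<And>n. emeasure lborel (B n \<inter> unit_square) \<le> ennreal ((1 / 2) ^ n)"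
    and h: "\<And>n. 0 \<le> h n" and \<epsilon>: "0 < \<epsilon>"
  shows "\<exists>\<mu> n0. weight \<mu> \<and> measure lebesgue {p \<in> unit_square. \<mu> p \<noteq> 1} < \<epsilon> \<and>
    (\<forall>n\<ge>n0. AE p in lebesgue_on unit_square. p \<in> B n \<longrightarrow> h n * \<mu> p \<le> (1 / 2) ^ n)"
proof -
  obtain n0 where n0: "(1 / 2) ^ n0 < \<epsilon> / 2"
    using \<epsilon> real_arch_pow_inv [of "\<epsilon> / 2" "1 / 2"] by auto
  \<comment> \<open>Only blocks from \<open>n0\<close> on lower the weight, so it differs from 1 at
    most on a union of measure \<open>2 * (1 / 2) ^ n0\<close>.\<close>
  define g where "g n p = (if n0 \<le> n \<and> p \<in> B n then h n * 2 ^ n else 0)" for n p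
  define G where "G p = (\<Sum>n. ennreal (g n p))" for p
  define \<mu> where "\<mu> p = 1 / (1 + enn2real (G p))" for p
  have [measurable]: "g n \<in> borel_measurable borel" for n
    unfolding g_def [abs_def] by measurable
  have [measurable]: "G \<in> borel_measurable borel"
    unfolding G_def [abs_def] by measurable
  have \<mu>_meas [measurable]: "\<mu> \<in> borel_measurable borel"
    unfolding \<mu>_def [abs_def] by measurable
  have "weight \<mu>"
  proof
    show "\<mu> \<in> borel_measurable (lebesgue_on unit_square)"
      by (rule borel_imp_lebesgue_on) fact
  qed (auto simp: \<mu>_def add_pos_nonneg)
  moreover have "measure lebesgue {p \<in> unit_square. \<mu> p \<noteq> 1} < \<epsilon>"
  proof -
    have sub: "{p \<in> unit_square. \<mu> p \<noteq> 1} \<subseteq> (\<Union>n. B (n + n0) \<inter> unit_square)"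
    proof
      fix p assume "p \<in> {p \<in> unit_square. \<mu> p \<noteq> 1}"
      then have p: "p \<in> unit_square" "\<mu> p \<noteq> 1" by auto
      have "\<exists>n\<ge>n0. p \<in> B n"
      proof (rule ccontr)
        assume "\<not> (\<exists>n\<ge>n0. p \<in> B n)"
        then have "g n p = 0" for n by (auto simp: g_def)
        then have "G p = 0" by (simp add: G_def)
        with p show False by (simp add: \<mu>_def)
      qed
      then obtain n where "n0 \<le> n" "p \<in> B n" by blast
      with p have "p \<in> B ((n - n0) + n0) \<inter> unit_square" by simp
      then show "p \<in> (\<Union>n. B (n + n0) \<inter> unit_square)" by blast
    qed
    have "{p \<in> space borel. p \<in> unit_square \<and> \<mu> p \<noteq> 1} \<in> sets borel" by measurable
    then have sets: "{p \<in> unit_square. \<mu> p \<noteq> 1} \<in> sets borel" by simp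
    have "emeasure lborel {p \<in> unit_square. \<mu> p \<noteq> 1} \<le> emeasure lborel (\<Union>n. B (n + n0) \<inter> unit_square)"
      by (rule emeasure_mono [OF sub]) auto
    also have "\<dots> \<le> (\<Sum>n. emeasure lborel (B (n + n0) \<inter> unit_square))"
      by (rule emeasure_subadditive_countably) auto
    also have "\<dots> \<le> (\<Sum>n. ennreal ((1 / 2) ^ (n + n0)))"
      by (intro suminf_le Bm summableI)
    also have "\<dots> = ennreal (2 * (1 / 2) ^ n0)"
    proof -
      have "(\<lambda>n. (1 / 2 :: real) ^ n * (1 / 2) ^ n0) sums (1 / (1 - 1 / 2) * (1 / 2) ^ n0)"
        by (intro sums_mult2 geometric_sums) simp
      then show ?thesis
        by (intro sums_unique [symmetric] sums_ennreal [THEN iffD2]) (auto simp: power_add)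
    qed
    finally have "emeasure lborel {p \<in> unit_square. \<mu> p \<noteq> 1} \<le> ennreal (2 * (1 / 2) ^ n0)" .
    then have "measure lborel {p \<in> unit_square. \<mu> p \<noteq> 1} \<le> 2 * (1 / 2) ^ n0"
      unfolding measure_def by (intro enn2real_leI) auto
    moreover have "measure lebesgue {p \<in> unit_square. \<mu> p \<noteq> 1} = measure lborel {p \<in> unit_square. \<mu> p \<noteq> 1}"
      using sets by (intro measure_completion) simp
    ultimately show ?thesis using n0 by simp
  qed
  moreover have "AE p in lebesgue_on unit_square. p \<in> B n \<longrightarrow> h n * \<mu> p \<le> (1 / 2) ^ n" if "n0 \<le> n" for n
  proof -
    \<comment> \<open>The Borel-Cantelli lemma: almost everywhere the sum defining \<open>G\<close>
      is finite, so \<open>enn2real\<close> does not collapse it.\<close>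
    have "AE p in lborel. \<forall>\<^sub>F n in sequentially. p \<in> space lborel - (B n \<inter> unit_square)"
    proof (rule borel_cantelli_AE1)
      show "emeasure lborel (B n \<inter> unit_square) < \<infinity>" for n
        using Bm [of n] by (rule order_le_less_trans) simp
      show "summable (\<lambda>n. measure lborel (B n \<inter> unit_square))"
      proof (rule summable_comparison_test')
        show "summable (\<lambda>n. (1 / 2 :: real) ^ n)" by (rule summable_geometric) simp
        show "norm (measure lborel (B n \<inter> unit_square)) \<le> (1 / 2) ^ n" for n
          using Bm [of n] unfolding measure_def by (auto intro!: enn2real_leI)
      qed
    qed auto
    from AE_unit_square [OF this] have "AE p in lebesgue_on unit_square. \<forall>\<^sub>F n in sequentially. p \<notin> B n \<inter> unit_square"
      by simp
    moreover have "AE p in lebesgue_on unit_square. p \<in> unit_square"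
      by (rule AE_I2) simp
    ultimately show ?thesis
    proof eventually_elim
      case (elim p)
      then obtain m where m: "\<And>k. m \<le> k \<Longrightarrow> p \<notin> B k"
        unfolding eventually_sequentially by auto
      have "G p = (\<Sum>k<m. ennreal (g k p))"
        unfolding G_def by (rule suminf_finite) (use m in \<open>auto simp: g_def not_less\<close>)
      also have "\<dots> = ennreal (\<Sum>k<m. g k p)"
        by (rule sum_ennreal) (simp add: g_def h)
      finally have "enn2real (G p) = (\<Sum>k<m. g k p)"
        by (simp add: sum_nonneg g_def h)
      show ?case
      proof
        assume p: "p \<in> B n"
        then have "n < m" using m not_less by blast
        then have "g n p \<le> (\<Sum>k<m. g k p)"
          by (intro member_le_sum) (auto simp: g_def h)
        then have "h n * 2 ^ n \<le> enn2real (G p)"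
          using p that \<open>enn2real (G p) = _\<close> by (simp add: g_def)
        then have "h n * 2 ^ n \<le> 1 + enn2real (G p)" by simp
        moreover have "0 < 1 + enn2real (G p)" by (simp add: add_pos_nonneg)
        ultimately show "h n * \<mu> p \<le> (1 / 2) ^ n"
          by (simp add: \<mu>_def field_simps power_one_over)
      qed
    qed
  qed
  ultimately show ?thesis by blast
qed

section \<open>The greedy selection\<close>

text \<open>What the selection uses, expressed in weighted norms alone. From \<open>n0\<close> on
  the weight controls the exceptional sets; earlier blocks are never selected.\<close>

locale approximating_blocks = weight +
  fixes a :: "nat \<Rightarrow> nat \<Rightarrow> nat \<Rightarrow> real" and N :: "nat \<Rightarrow> nat" and F :: "nat \<Rightarrow> real \<times> real \<Rightarrow> real"
    and n0 :: nat
  assumes N: "strict_mono N" and N0: "1 \<le> N 0"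
    and supp: "\<And>n k l. a n k l \<noteq> 0 \<Longrightarrow> k \<in> {N n..<N (Suc n)} \<and> l \<in> {N n..<N (Suc n)}"
    and F_measurable [measurable]: "\<And>n. F n \<in> borel_measurable (lebesgue_on unit_square)"
    and F_dense: "\<And>f \<eta> m. \<lbrakk>f \<in> weighted_L1 \<mu>; 0 < \<eta>\<rbrakk> \<Longrightarrow> \<exists>n\<ge>m. weighted_norm \<mu> (\<lambda>p. f p - F n p) < \<eta>"
    and block_approx: "\<And>n. n0 \<le> n \<Longrightarrow>
      weighted_norm \<mu> (\<lambda>p. F n p - wsum ({1..<N (Suc n)} \<times> {1..<N (Suc n)}) (a n) p) \<le> ennreal (2 * (1 / 2) ^ n)"
    and block_partial: "\<And>n A. \<lbrakk>n0 \<le> n; exhausting A\<rbrakk> \<Longrightarrow>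
      weighted_norm \<mu> (wsum A (a n)) \<le> weighted_norm \<mu> (F n) + ennreal (2 * (1 / 2) ^ n)"
begin

abbreviation Q :: "nat \<Rightarrow> real \<times> real \<Rightarrow> real" where
  "Q n \<equiv> wsum ({1..<N (Suc n)} \<times> {1..<N (Suc n)}) (a n)"

lemma wsum_measurable' [measurable]: "wsum A b \<in> borel_measurable (lebesgue_on unit_square)"
  by (rule borel_imp_lebesgue_on) measurable

text \<open>The left-hand side of the inequality bounds the norm of \<open>g - Q n\<close>, so that subtracting a selected
  block halves the norm of the residual \<open>g\<close>.\<close>

definition selected :: "nat \<Rightarrow> (real \<times> real \<Rightarrow> real) \<Rightarrow> bool" where
  "selected n g \<longleftrightarrow> n0 \<le> n \<and>
     weighted_norm \<mu> (\<lambda>p. g p - F n p) + ennreal (2 * (1 / 2) ^ n) \<le> weighted_norm \<mu> g / 2"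

primrec residual :: "(real \<times> real \<Rightarrow> real) \<Rightarrow> nat \<Rightarrow> real \<times> real \<Rightarrow> real" where
  "residual f 0 = f"
| "residual f (Suc n) =
     (if selected n (residual f n) then (\<lambda>p. residual f n p - Q n p) else residual f n)"

lemma residual_measurable [measurable]:
  "f \<in> borel_measurable (lebesgue_on unit_square) \<Longrightarrow> residual f n \<in> borel_measurable (lebesgue_on unit_square)"
proof (induction n)
  case (Suc n)
  then have [measurable]: "residual f n \<in> borel_measurable (lebesgue_on unit_square)" by simp
  show ?case by simp
qed simp

text \<open>The triangle inequality through \<open>F n\<close>: the residual is close to
  \<open>F n\<close> by selection, and \<open>F n\<close> to \<open>Q n\<close> by
  \<open>block_approx\<close>.\<close>

lemma residual_Suc_le:
  assumes [measurable]: "f \<in> borel_measurable (lebesgue_on unit_square)" and sel: "selected n (residual f n)"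
  shows "weighted_norm \<mu> (residual f (Suc n)) \<le> weighted_norm \<mu> (residual f n) / 2"
proof -
  have "weighted_norm \<mu> (residual f (Suc n))
      \<le> weighted_norm \<mu> (\<lambda>p. residual f n p - F n p) + weighted_norm \<mu> (\<lambda>p. F n p - Q n p)"
    using sel by simp (rule weighted_norm_diff_triangle; measurable)
  also have "\<dots> \<le> weighted_norm \<mu> (\<lambda>p. residual f n p - F n p) + ennreal (2 * (1 / 2) ^ n)"
    using sel by (intro add_left_mono block_approx) (simp add: selected_def)
  also have "\<dots> \<le> weighted_norm \<mu> (residual f n) / 2"
    using sel by (simp add: selected_def)
  finally show ?thesis .
qed

lemma half_le_ennreal: "(x :: ennreal) / 2 \<le> x"
proof (cases x)
  case (real r)
  then have "x / 2 = ennreal (r / 2)"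
    using divide_ennreal [of r 2] by simp
  with real show ?thesis by (simp add: ennreal_leI)
qed simp

lemma residual_antimono:
  assumes "f \<in> borel_measurable (lebesgue_on unit_square)"
  shows "weighted_norm \<mu> (residual f (Suc n)) \<le> weighted_norm \<mu> (residual f n)"
proof (cases "selected n (residual f n)")
  case True
  show ?thesis
    by (rule order_trans [OF residual_Suc_le [OF assms True] half_le_ennreal])
qed simp

text \<open>The norms decrease to some \<open>L\<close>. If \<open>L\<close> is positive, they are
  eventually below \<open>2 * L\<close>, where one more selection would push them under
  \<open>L\<close>; hence the residual becomes constant. But by density some later
  \<open>F n\<close> is so close to it that block \<open>n\<close> must be selected.\<close>

lemma residual_tendsto_0:
  assumes f: "f \<in> weighted_L1 \<mu>"
  shows "(\<lambda>n. weighted_norm \<mu> (residual f n)) \<longlonglongrightarrow> 0"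
proof -
  have meas [measurable]: "f \<in> borel_measurable (lebesgue_on unit_square)" and fin: "weighted_norm \<mu> f < \<infinity>"
    using f by (auto simp: weighted_L1_def)
  define \<rho> where "\<rho> n = weighted_norm \<mu> (residual f n)" for n
  have dec: "decseq \<rho>"
    unfolding \<rho>_def by (rule decseq_SucI) (rule residual_antimono [OF meas])
  have \<rho>_fin: "\<rho> n < \<infinity>" for n
    using decseqD [OF dec, of 0 n] fin by (simp add: \<rho>_def order_le_less_trans)
  define L where "L = (INF n. \<rho> n)"
  have lim: "\<rho> \<longlonglongrightarrow> L"
    unfolding L_def by (rule LIMSEQ_INF [OF dec])
  have L_le: "L \<le> \<rho> n" for n
    unfolding L_def by (rule INF_lower) simp
  have "L = 0"
  proof (rule ccontr)
    assume "L \<noteq> 0"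
    then have "0 < L" by (simp add: zero_less_iff_neq_zero)
    have "L < \<infinity>" using L_le [of 0] \<rho>_fin [of 0] by (rule order_le_less_trans)
    then obtain l where l: "L = ennreal l" "0 < l"
      using \<open>0 < L\<close> by (cases L) auto
    have "L < ennreal (2 * l)" using l by (simp add: ennreal_less_iff)
    then have "\<forall>\<^sub>F n in sequentially. \<rho> n < ennreal (2 * l)"
      by (rule order_tendstoD(2) [OF lim])
    then obtain n1 where n1: "\<And>n. n1 \<le> n \<Longrightarrow> \<rho> n < ennreal (2 * l)"
      unfolding eventually_sequentially by blast
    have nosel: "\<not> selected n (residual f n)" if "n1 \<le> n" for n
    proof
      assume "selected n (residual f n)"
      then have "\<rho> (Suc n) \<le> \<rho> n / 2"
        unfolding \<rho>_def by (rule residual_Suc_le [OF meas])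
      also have "\<dots> < ennreal (2 * l) / 2"
        using n1 [OF that] by (simp add: divide_less_ennreal ennreal_divide_times ennreal_times_divide mult_divide_eq_ennreal)
      also have "\<dots> = L"
        using l by (simp add: divide_ennreal flip: ennreal_numeral)
      finally show False using L_le [of "Suc n"] by simp
    qed
    define g where "g = residual f n1"
    have const: "residual f n = g" if "n1 \<le> n" for n
      using that
    proof (induction n rule: dec_induct)
      case (step n)
      then show ?case using nosel [of n] by simp
    qed (simp add: g_def)
    have g_meas [measurable]: "g \<in> borel_measurable (lebesgue_on unit_square)"
      unfolding g_def by measurable
    have g_L1: "g \<in> weighted_L1 \<mu>"
      using \<rho>_fin [of n1] by (simp add: weighted_L1_def \<rho>_def g_def [symmetric])
    \<comment> \<open>Both the distance to \<open>F n\<close> and the block error are brought down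
      to a quarter of \<open>L\<close>; together they reach the threshold \<open>L / 2\<close> of
      the selection rule.\<close>
    obtain n2 where "(1 / 2) ^ n2 < l / 8"
      using l real_arch_pow_inv [of "l / 8" "1 / 2"] by auto
    then have n2: "2 * (1 / 2) ^ n2 < l / 4" by linarith
    have "0 < ennreal (l / 4)" using l by simp
    from F_dense [OF g_L1 this, of "max n0 (max n1 n2)"] obtain n
      where n: "n0 \<le> n" "n1 \<le> n" "n2 \<le> n" and near: "weighted_norm \<mu> (\<lambda>p. g p - F n p) < ennreal (l / 4)"
      by auto
    have "(1 / 2 :: real) ^ n \<le> (1 / 2) ^ n2"
      using n by (intro power_decreasing) auto
    with n2 have "2 * (1 / 2) ^ n \<le> l / 4" by linarith
    then have "weighted_norm \<mu> (\<lambda>p. g p - F n p) + ennreal (2 * (1 / 2) ^ n) \<le> ennreal (l / 4) + ennreal (l / 4)"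
      using near by (intro add_mono ennreal_leI) auto
    also have "\<dots> = L / 2"
      using l by (simp add: divide_ennreal flip: ennreal_plus ennreal_numeral)
    also have "\<dots> \<le> \<rho> n1 / 2"
      by (rule divide_right_mono_ennreal [OF L_le])
    finally have "selected n (residual f n)"
      using n by (simp add: selected_def const \<rho>_def g_def [symmetric])
    with nosel [OF n(2)] show False by simp
  qed
  with lim show ?thesis by (simp add: \<rho>_def [abs_def])
qed

definition selection :: "(real \<times> real \<Rightarrow> real) \<Rightarrow> nat \<Rightarrow> nat \<Rightarrow> real" where
  "selection f k l = of_bool (\<exists>n. selected n (residual f n) \<and> a n k l \<noteq> 0)"

definition selected_block :: "(real \<times> real \<Rightarrow> real) \<Rightarrow> nat \<Rightarrow> nat \<Rightarrow> nat \<Rightarrow> real" where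
  "selected_block f n = (if selected n (residual f n) then a n else (\<lambda>_ _. 0))"

lemma selected_block_supp:
  "selected_block f n k l \<noteq> 0 \<Longrightarrow> k \<in> {N n..<N (Suc n)} \<and> l \<in> {N n..<N (Suc n)}"
  by (rule supp) (auto simp: selected_block_def split: if_splits)

text \<open>Since the blocks are disjoint, choosing terms of the glued series amounts to gluing the
  chosen blocks, so \<open>wsum_glue\<close> applies to the subseries.\<close>

lemma selection_mult_glue: "selection f k l * glue a k l = glue (selected_block f) k l"
proof -
  have eq: "glue a k l = a n k l" "glue (selected_block f) k l = selected_block f n k l" if "a n k l \<noteq> 0" for n
    by (rule glue_block [where a = a, OF N] glue_block [where a = "selected_block f", OF N];
        use supp [of _ k l] supp selected_block_supp that in blast)+
  show ?thesis
  proof (cases "\<exists>n. a n k l \<noteq> 0")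
    case True
    then obtain n where n: "a n k l \<noteq> 0" by blast
    show ?thesis
    proof (cases "selected n (residual f n)")
      case True
      then have "selection f k l = 1" using n by (auto simp: selection_def)
      with True show ?thesis by (simp add: eq [OF n] selected_block_def)
    next
      case False
      then have 0: "glue (selected_block f) k l = 0" by (simp add: eq [OF n] selected_block_def)
      have "selection f k l = 0"
      proof (rule ccontr)
        assume "selection f k l \<noteq> 0"
        then obtain n' where "selected n' (residual f n')" "a n' k l \<noteq> 0" by (auto simp: selection_def)
        with eq(2) [of n'] 0 show False by (simp add: selected_block_def)
      qed
      with 0 show ?thesis by simp
    qed
  next
    case False
    then have "a n k l = 0" "selected_block f n k l = 0" for n
      by (auto simp: selected_block_def)
    then show ?thesis by (simp add: glue_def)
  qed
qed

text \<open>Telescoping: each selected block is exactly what the residual loses.\<close>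

lemma sum_selected_blocks:
  "(\<Sum>n<m. wsum ({1..<N (Suc n)} \<times> {1..<N (Suc n)}) (selected_block f n) p) = f p - residual f m p"
  by (induction m) (auto simp: selected_block_def wsum_def)

text \<open>The error consists of the residual at the cut block \<open>m\<close> and a part of that
  block. If the block is selected, \<open>block_partial\<close> bounds the part through the norm of
  \<open>F m\<close>, and the selection inequality turns this into 3/2 of the norm of the residual;
  otherwise the part is zero.\<close>

lemma partial_sum_bound:
  assumes f: "f \<in> weighted_L1 \<mu>" and A: "exhausting A"
  obtains m where
    "weighted_norm \<mu> (\<lambda>p. wsum A (\<lambda>k l. selection f k l * glue a k l) p - f p)
       \<le> weighted_norm \<mu> (residual f m) + (weighted_norm \<mu> (residual f m) + weighted_norm \<mu> (residual f m) / 2)"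
    "\<And>M. {1..<N M} \<times> {1..<N M} \<subseteq> A \<Longrightarrow> M \<le> m"
proof -
  have [measurable]: "f \<in> borel_measurable (lebesgue_on unit_square)"
    using f by (auto simp: weighted_L1_def)
  obtain m where m: "\<And>p. wsum A (glue (selected_block f)) p
      = (\<Sum>n<m. wsum ({1..<N (Suc n)} \<times> {1..<N (Suc n)}) (selected_block f n) p) + wsum A (selected_block f m) p"
    and le: "\<And>M. {1..<N M} \<times> {1..<N M} \<subseteq> A \<Longrightarrow> M \<le> m"
    using wsum_glue [where a = "selected_block f", OF N selected_block_supp [of f] N0 A] by blast
  let ?r = "residual f m"
  have "wsum A (\<lambda>k l. selection f k l * glue a k l) p - f p = wsum A (selected_block f m) p - ?r p" for p
    unfolding selection_mult_glue m sum_selected_blocks by simp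
  then have "weighted_norm \<mu> (\<lambda>p. wsum A (\<lambda>k l. selection f k l * glue a k l) p - f p)
      = weighted_norm \<mu> (\<lambda>p. ?r p + - wsum A (selected_block f m) p)"
    by (simp add: weighted_norm_minus)
  also have "\<dots> \<le> weighted_norm \<mu> ?r + weighted_norm \<mu> (\<lambda>p. - wsum A (selected_block f m) p)"
    by (rule weighted_norm_add) measurable
  also have "weighted_norm \<mu> (\<lambda>p. - wsum A (selected_block f m) p) = weighted_norm \<mu> (wsum A (selected_block f m))"
    by (simp add: weighted_norm_def)
  also have "\<dots> \<le> weighted_norm \<mu> ?r + weighted_norm \<mu> ?r / 2"
  proof (cases "selected m ?r")
    case True
    have "weighted_norm \<mu> (wsum A (selected_block f m)) \<le> weighted_norm \<mu> (F m) + ennreal (2 * (1 / 2) ^ m)"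
      using True A block_partial [of m A] by (simp add: selected_block_def selected_def)
    also have "weighted_norm \<mu> (F m) \<le> weighted_norm \<mu> ?r + weighted_norm \<mu> (\<lambda>p. ?r p - F m p)"
      using weighted_norm_add [of ?r "\<lambda>p. F m p - ?r p"] by (simp add: weighted_norm_minus [of "F m"])
    also have "weighted_norm \<mu> ?r + weighted_norm \<mu> (\<lambda>p. ?r p - F m p) + ennreal (2 * (1 / 2) ^ m)
        \<le> weighted_norm \<mu> ?r + weighted_norm \<mu> ?r / 2"
      using True unfolding add.assoc by (intro add_left_mono) (simp add: selected_def)
    finally show ?thesis by (simp add: add_right_mono)
  next
    case False
    then show ?thesis by (simp add: selected_block_def wsum_def weighted_norm_def)
  qed
  finally show thesis using le by (intro that) (auto simp: add_left_mono)
qed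

text \<open>A set containing the square below \<open>N n1\<close> cuts no block before
  \<open>n1\<close>, so the bound is uniform over all such exhausting sets, whatever their
  shape.\<close>

lemma partial_sums_converge:
  assumes f: "f \<in> weighted_L1 \<mu>" and \<eta>: "0 < \<eta>"
  obtains M where "\<And>A. \<lbrakk>exhausting A; {1..<M} \<times> {1..<M} \<subseteq> A\<rbrakk> \<Longrightarrow>
    weighted_norm \<mu> (\<lambda>p. wsum A (\<lambda>k l. selection f k l * glue a k l) p - f p) < \<eta>"
proof -
  let ?\<rho> = "\<lambda>n. weighted_norm \<mu> (residual f n)"
  have "(\<lambda>n. ?\<rho> n + (?\<rho> n + ?\<rho> n)) \<longlonglongrightarrow> 0 + (0 + 0)"
    by (intro tendsto_add residual_tendsto_0 f)
  then have "\<forall>\<^sub>F n in sequentially. ?\<rho> n + (?\<rho> n + ?\<rho> n) < \<eta>"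
    using \<eta> by (intro order_tendstoD(2)) auto
  then obtain n1 where n1: "\<And>n. n1 \<le> n \<Longrightarrow> ?\<rho> n + (?\<rho> n + ?\<rho> n) < \<eta>"
    unfolding eventually_sequentially by blast
  show thesis
  proof (rule that [of "N n1"])
    fix A assume A: "exhausting A" "{1..<N n1} \<times> {1..<N n1} \<subseteq> A"
    obtain m where m: "weighted_norm \<mu> (\<lambda>p. wsum A (\<lambda>k l. selection f k l * glue a k l) p - f p)
        \<le> ?\<rho> m + (?\<rho> m + ?\<rho> m / 2)" and "\<And>M. {1..<N M} \<times> {1..<N M} \<subseteq> A \<Longrightarrow> M \<le> m"
      using partial_sum_bound [OF f A(1)] by blast
    with A(2) have "n1 \<le> m" by blast
    note m
    also have "?\<rho> m + (?\<rho> m + ?\<rho> m / 2) \<le> ?\<rho> m + (?\<rho> m + ?\<rho> m)"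
      by (intro add_left_mono half_le_ennreal)
    also have "\<dots> < \<eta>" by (rule n1) fact
    finally show "weighted_norm \<mu> (\<lambda>p. wsum A (\<lambda>k l. selection f k l * glue a k l) p - f p) < \<eta>" .
  qed
qed

end

section \<open>Rectangles and discs as exhausting sets, and universality\<close>

lemma exhausting_rectangle: "exhausting ({1..n} \<times> {1..m})"
  unfolding exhausting_def
proof (intro conjI allI)
  fix N
  show "{1..<N} \<times> {1..<N} \<subseteq> {1..n} \<times> {1..m} \<or> {1..n} \<times> {1..m} \<inter> {N..} \<times> {N..} = {}"
    by (cases "N \<le> Suc (min n m)") auto
qed simp

definition disc :: "real \<Rightarrow> (nat \<times> nat) set" where
  "disc R = {(k, l). 1 \<le> k \<and> 1 \<le> l \<and> (real k)\<^sup>2 + (real l)\<^sup>2 \<le> R\<^sup>2}"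

lemma square_subset_disc:
  assumes "2 * (real N)\<^sup>2 \<le> R\<^sup>2"
  shows "{1..<N} \<times> {1..<N} \<subseteq> disc R"
proof
  fix q assume "q \<in> {1..<N} \<times> {1..<N}"
  then obtain k l where q: "q = (k, l)" "1 \<le> k" "k < N" "1 \<le> l" "l < N" by auto
  then have "(real k)\<^sup>2 \<le> (real N)\<^sup>2" "(real l)\<^sup>2 \<le> (real N)\<^sup>2" by (auto intro: power_mono)
  with assms have "(real k)\<^sup>2 + (real l)\<^sup>2 \<le> R\<^sup>2" by linarith
  with q show "q \<in> disc R" by (simp add: disc_def)
qed

text \<open>The alternative is decided by whether the point \<open>(N, N)\<close> satisfies the
  inequality of the disc.\<close>

lemma exhausting_disc: "exhausting (disc R)"
  unfolding exhausting_def
proof (intro conjI allI)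
  show "finite (disc R)"
    unfolding disc_def by (rule finite_spherical_index_set)
  fix N
  show "{1..<N} \<times> {1..<N} \<subseteq> disc R \<or> disc R \<inter> {N..} \<times> {N..} = {}"
  proof (cases "2 * (real N)\<^sup>2 \<le> R\<^sup>2")
    case False
    have "q \<notin> disc R" if "q \<in> {N..} \<times> {N..}" for q
    proof
      assume "q \<in> disc R"
      then obtain k l where q: "q = (k, l)" "(real k)\<^sup>2 + (real l)\<^sup>2 \<le> R\<^sup>2" by (auto simp: disc_def)
      have "(real N)\<^sup>2 \<le> (real k)\<^sup>2" "(real N)\<^sup>2 \<le> (real l)\<^sup>2" using that q by (auto intro: power_mono)
      with q False show False by linarith
    qed
    then show ?thesis by blast
  next
    case True
    then show ?thesis using square_subset_disc by blast
  qed
qed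

lemma rect_partial_sum_eq: "rect_partial_sum c n m = wsum ({1..n} \<times> {1..m}) c"
  unfolding rect_partial_sum_def wsum_def sum.cartesian_product [symmetric] by (auto simp: case_prod_beta)

lemma spherical_partial_sum_eq: "spherical_partial_sum c R = wsum (disc R) c"
  unfolding spherical_partial_sum_def wsum_def disc_def by (auto simp: case_prod_beta)

lemma (in approximating_blocks) universal: "universal_subseries \<mu> (glue a)"
  unfolding universal_subseries_def
proof (intro ballI exI [of _ "selection _"] conjI)
  fix f assume f: "f \<in> weighted_L1 \<mu>"
  show "\<forall>k \<nu>. selection f k \<nu> \<in> {0, 1}"
    by (auto simp: selection_def)
  let ?c = "\<lambda>k \<nu>. selection f k \<nu> * glue a k \<nu>"
  show "((\<lambda>(n, m). weighted_norm \<mu> (\<lambda>p. rect_partial_sum ?c n m p - f p)) \<longlongrightarrow> 0) (sequentially \<times>\<^sub>F sequentially)"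
  proof (rule order_tendstoI)
    fix \<eta> :: ennreal assume "0 < \<eta>"
    then obtain M where M: "\<And>A. \<lbrakk>exhausting A; {1..<M} \<times> {1..<M} \<subseteq> A\<rbrakk> \<Longrightarrow>
        weighted_norm \<mu> (\<lambda>p. wsum A ?c p - f p) < \<eta>"
      using partial_sums_converge [OF f] by blast
    have "weighted_norm \<mu> (\<lambda>p. rect_partial_sum ?c n m p - f p) < \<eta>" if "M \<le> n" "M \<le> m" for n m
      unfolding rect_partial_sum_eq by (rule M [OF exhausting_rectangle]) (use that in auto)
    then show "\<forall>\<^sub>F x in sequentially \<times>\<^sub>F sequentially.
        (case x of (n, m) \<Rightarrow> weighted_norm \<mu> (\<lambda>p. rect_partial_sum ?c n m p - f p)) < \<eta>"
      unfolding eventually_prod_sequentially by auto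
  qed simp
  show "((\<lambda>R. weighted_norm \<mu> (\<lambda>p. spherical_partial_sum ?c R p - f p)) \<longlongrightarrow> 0) at_top"
  proof (rule order_tendstoI)
    fix \<eta> :: ennreal assume "0 < \<eta>"
    then obtain M where M: "\<And>A. \<lbrakk>exhausting A; {1..<M} \<times> {1..<M} \<subseteq> A\<rbrakk> \<Longrightarrow>
        weighted_norm \<mu> (\<lambda>p. wsum A ?c p - f p) < \<eta>"
      using partial_sums_converge [OF f] by blast
    have "weighted_norm \<mu> (\<lambda>p. spherical_partial_sum ?c R p - f p) < \<eta>" if "2 * real M \<le> R" for R
      unfolding spherical_partial_sum_eq
    proof (rule M [OF exhausting_disc square_subset_disc])
      have "2 * (real M)\<^sup>2 \<le> (2 * real M)\<^sup>2" by (simp add: power_mult_distrib)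
      also have "\<dots> \<le> R\<^sup>2" using that by (intro power_mono) auto
      finally show "2 * (real M)\<^sup>2 \<le> R\<^sup>2" .
    qed
    then show "\<forall>\<^sub>F R in at_top. weighted_norm \<mu> (\<lambda>p. spherical_partial_sum ?c R p - f p) < \<eta>"
      unfolding eventually_at_top_linorder by blast
  qed simp
qed

section \<open>Enumeration of the step functions and construction of the series\<close>

definition step_seq :: "nat \<Rightarrow> real \<times> real \<Rightarrow> real" where
  "step_seq n = (case from_nat n :: nat \<times> nat \<times> int list of (_, d, L) \<Rightarrow> list_step d L)"

lemma step_seq_eq_step: "\<exists>d v. step_seq n = step d v"
  by (auto simp: step_seq_def list_step_def split: prod.split)

text \<open>The first component of the code is irrelevant for \<open>step_seq\<close>; it makes every step function
  recur infinitely often.\<close>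

lemma step_seq_recurs: "\<exists>n\<ge>m. step_seq n = list_step d L"
proof -
  have "inj (\<lambda>k. to_nat (k :: nat, d, L))"
    by (rule injI) simp
  then have "infinite (range (\<lambda>k. to_nat (k :: nat, d, L)))"
    by (simp add: finite_image_iff)
  then obtain k where "m \<le> to_nat (k :: nat, d, L)"
    unfolding infinite_nat_iff_unbounded_le by blast
  then show ?thesis
    by (intro exI [of _ "to_nat (k, d, L)"]) (simp add: step_seq_def)
qed

lemma step_seq_block_exists:
  assumes "1 \<le> N0"
  shows "\<exists>a N1 B. approximating_block ((1 / 2) ^ n) (step_seq n) N0 a N1 B"
proof -
  obtain d v where "step_seq n = step d v" using step_seq_eq_step by blast
  then show ?thesis using approximating_block_exists [OF _ assms] by simp
qed

text \<open>Dependent choice: each block starts where the previous one ended, with tolerance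
  \<open>(1 / 2) ^ n\<close>. The invariant carries the lower bound 1 required for the next block,
  and its clause for \<open>n = 0\<close> fixes the starting point.\<close>

lemma block_sequence_exists:
  "\<exists>a N B. N 0 = 1 \<and> (\<forall>n. approximating_block ((1 / 2) ^ n) (step_seq n) (N n) (a n) (N (Suc n)) (B n))"
proof -
  have "\<exists>N. \<forall>n. (1 \<le> N n \<and> (n = 0 \<longrightarrow> N n = 1)) \<and> (\<exists>a B. approximating_block ((1 / 2) ^ n) (step_seq n) (N n) a (N (Suc n)) B)"
  proof (rule dependent_nat_choice)
    show "\<exists>x :: nat. 1 \<le> x \<and> (0 = (0 :: nat) \<longrightarrow> x = 1)" by auto
    fix x n :: nat
    assume x: "1 \<le> x \<and> (n = 0 \<longrightarrow> x = 1)"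
    then obtain a N1 B where b: "approximating_block ((1 / 2) ^ n) (step_seq n) x a N1 B" using step_seq_block_exists by blast
    then have "1 \<le> N1" by (auto simp: approximating_block_def)
    with b show "\<exists>y. (1 \<le> y \<and> (Suc n = 0 \<longrightarrow> y = 1)) \<and> (\<exists>a B. approximating_block ((1 / 2) ^ n) (step_seq n) x a y B)"
      by auto
  qed
  then obtain N where "N 0 = 1" "\<forall>n. \<exists>a B. approximating_block ((1 / 2) ^ n) (step_seq n) (N n) a (N (Suc n)) B"
    by blast
  then show ?thesis by metis
qed

theorem theorem3:
  shows "\<exists>c :: nat \<Rightarrow> nat \<Rightarrow> real.
    (\<forall>q :: real. q > 2 \<longrightarrow> (\<lambda>(n, k). \<bar>c n k\<bar> powr q) summable_on ({1..} \<times> {1..})) \<and>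
    (\<forall>\<epsilon> :: real. \<epsilon> > 0 \<longrightarrow>
      (\<exists>\<mu> :: real \<times> real \<Rightarrow> real.
         \<mu> \<in> borel_measurable (lebesgue_on unit_square) \<and>
         (\<forall>p \<in> unit_square. 0 < \<mu> p \<and> \<mu> p \<le> 1) \<and>
         measure lebesgue {p \<in> unit_square. \<mu> p \<noteq> 1} < \<epsilon> \<and>
         universal_subseries \<mu> c))"
proof -
  obtain a :: "nat \<Rightarrow> nat \<Rightarrow> nat \<Rightarrow> real" and N B
    where N0: "N 0 = 1" and spec: "\<And>n. approximating_block ((1 / 2) ^ n) (step_seq n) (N n) (a n) (N (Suc n)) (B n)"
    using block_sequence_exists by blast
  have N: "strict_mono N"
    using spec by (simp add: strict_mono_Suc_iff approximating_block_def)
  have supp: "k \<in> {N n..<N (Suc n)} \<and> l \<in> {N n..<N (Suc n)}" if "a n k l \<noteq> 0" for n k l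
    using spec [of n] that by (simp add: approximating_block_def)
  have B [measurable]: "B n \<in> sets borel" and Bm: "emeasure lborel (B n \<inter> unit_square) \<le> ennreal ((1 / 2) ^ n)" for n
    using spec [of n] by (simp_all add: approximating_block_def)
  define Q where "Q n = wsum ({1..<N (Suc n)} \<times> {1..<N (Suc n)}) (a n)" for n
  have Q: "Q n p = step_seq n p" if "p \<notin> B n" for n p
    using spec [of n] that unfolding approximating_block_def Q_def by blast
  have meas_seq [measurable]: "step_seq n \<in> borel_measurable borel" for n
    using step_seq_eq_step [of n] by auto
  have "\<exists>h. \<forall>p. \<bar>step_seq n p\<bar> \<le> h" for n
    using step_seq_eq_step [of n] abs_step_le by metis
  then obtain hF where hF: "\<And>n p. \<bar>step_seq n p\<bar> \<le> hF n" by metis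
  \<comment> \<open>Bounds both the step function and every partial sum of block \<open>n\<close>.
    It is fixed before \<open>\<epsilon>\<close> is given; the series is the same for all weights,
    and only \<open>\<mu>\<close> and \<open>n0\<close> depend on \<open>\<epsilon>\<close>.\<close>
  define h where "h n = (\<Sum>(k, l)\<in>{..<N (Suc n)} \<times> {..<N (Suc n)}. \<bar>a n k l\<bar>) + hF n" for n
  have hF0: "0 \<le> hF n" for n
    using hF [of n undefined] by (rule order_trans [OF abs_ge_zero])
  have h_step: "\<bar>step_seq n p\<bar> \<le> h n" for n p
    using hF [of n p] by (simp add: h_def case_prod_beta sum_nonneg add_increasing)
  have h_sum: "\<bar>wsum A (a n) p\<bar> \<le> h n" if A: "finite A" for A n p
  proof -
    have "\<bar>wsum A (a n) p\<bar> \<le> (\<Sum>(k, l)\<in>A. \<bar>a n k l\<bar>)" by (rule abs_wsum_le)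
    also have "\<dots> = (\<Sum>(k, l)\<in>A \<inter> {..<N (Suc n)} \<times> {..<N (Suc n)}. \<bar>a n k l\<bar>)"
      by (rule sum.mono_neutral_right [OF A]) (use supp [of n] in force)+
    also have "\<dots> \<le> (\<Sum>(k, l)\<in>{..<N (Suc n)} \<times> {..<N (Suc n)}. \<bar>a n k l\<bar>)"
      by (rule sum_mono2) auto
    finally show ?thesis using hF0 [of n] by (simp add: h_def)
  qed
  have h0: "0 \<le> h n" for n
    using h_step [of n undefined] by (rule order_trans [OF abs_ge_zero])
  show ?thesis
  proof (intro exI [of _ "glue a"] conjI allI impI)
    fix q :: real assume "2 < q"
    then show "(\<lambda>(n, k). \<bar>glue a n k\<bar> powr q) summable_on ({1..} \<times> {1..})"
      using spec by (intro summable_on_glue [OF N supp]) (auto simp: approximating_block_def)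
  next
    fix \<epsilon> :: real assume \<epsilon>: "0 < \<epsilon>"
    obtain \<mu> n0 where "weight \<mu>" and small: "measure lebesgue {p \<in> unit_square. \<mu> p \<noteq> 1} < \<epsilon>"
      and \<mu>B: "\<And>n. n0 \<le> n \<Longrightarrow> AE p in lebesgue_on unit_square. p \<in> B n \<longrightarrow> h n * \<mu> p \<le> (1 / 2) ^ n"
      using weight_exists [where B = B and h = h, OF B Bm h0 \<epsilon>] by blast
    interpret weight \<mu> by fact
    have total: "(\<integral>\<^sup>+ p. ennreal c \<partial>lebesgue_on unit_square) = ennreal c" for c
      using emeasure_unit_square by (simp add: emeasure_restrict_space)
    have sq: "AE p in lebesgue_on unit_square. p \<in> unit_square"
      by (rule AE_I2) simp
    have meas_seq' [measurable]: "step_seq n \<in> borel_measurable (lebesgue_on unit_square)" for n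
      by (rule borel_imp_lebesgue_on) measurable
    interpret approximating_blocks \<mu> a N step_seq n0
    proof
      show "strict_mono N" by (rule N)
      show "1 \<le> N 0" by (simp add: N0)
      show "k \<in> {N n..<N (Suc n)} \<and> l \<in> {N n..<N (Suc n)}" if "a n k l \<noteq> 0" for n k l
        using that by (rule supp)
      show "step_seq n \<in> borel_measurable (lebesgue_on unit_square)" for n
        by (rule meas_seq')
      show "\<exists>n\<ge>m. weighted_norm \<mu> (\<lambda>p. f p - step_seq n p) < \<eta>"
        if "f \<in> weighted_L1 \<mu>" "0 < \<eta>" for f \<eta> m
      proof -
        obtain d L where "weighted_norm \<mu> (\<lambda>p. f p - list_step d L p) < \<eta>"
          using list_step_dense [OF \<open>f \<in> _\<close> \<open>0 < \<eta>\<close>] .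
        moreover obtain n where "m \<le> n" "step_seq n = list_step d L"
          using step_seq_recurs by blast
        ultimately show ?thesis by auto
      qed
      fix n assume n: "n0 \<le> n"
      show "weighted_norm \<mu> (\<lambda>p. step_seq n p - wsum ({1..<N (Suc n)} \<times> {1..<N (Suc n)}) (a n) p)
          \<le> ennreal (2 * (1 / 2) ^ n)"
      proof -
        have "weighted_norm \<mu> (\<lambda>p. step_seq n p - Q n p)
            \<le> (\<integral>\<^sup>+ p. ennreal (2 * (1 / 2) ^ n) \<partial>lebesgue_on unit_square)"
          unfolding weighted_norm_def
        \<comment> \<open>Off \<open>B n\<close> the difference is zero; on \<open>B n\<close> it is
          at most \<open>2 * h n\<close>, which the weight reduces to
          \<open>2 * (1 / 2) ^ n\<close>.\<close>
        proof (rule nn_integral_mono_AE)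
          show "AE p in lebesgue_on unit_square. ennreal (\<bar>step_seq n p - Q n p\<bar> * \<mu> p) \<le> ennreal (2 * (1 / 2) ^ n)"
            using \<mu>B [OF n] sq
          proof eventually_elim
            case (elim p)
            show ?case
            proof (cases "p \<in> B n")
              case True
              have "\<bar>step_seq n p - Q n p\<bar> \<le> 2 * h n"
                using h_step [of n p] h_sum [of "{1..<N (Suc n)} \<times> {1..<N (Suc n)}" n p]
                unfolding Q_def by fastforce
              then have "\<bar>step_seq n p - Q n p\<bar> * \<mu> p \<le> 2 * h n * \<mu> p"
                using \<mu>_pos [of p] elim by (intro mult_right_mono) simp_all
              also have "\<dots> \<le> 2 * (1 / 2) ^ n" using elim True by simp
              finally show ?thesis by (rule ennreal_leI)
            qed (simp add: Q)
          qed
        qed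
        then show ?thesis unfolding total Q_def .
      qed
      show "weighted_norm \<mu> (wsum A (a n)) \<le> weighted_norm \<mu> (step_seq n) + ennreal (2 * (1 / 2) ^ n)"
        if A: "exhausting A" for A
      proof -
        obtain H where H_meas: "H \<in> borel_measurable borel"
          and H: "(\<integral>\<^sup>+ p. ennreal \<bar>H p\<bar> \<partial>lebesgue_on unit_square) \<le> ennreal ((1 / 2) ^ n)"
          and le: "\<And>p. p \<notin> B n \<Longrightarrow> \<bar>wsum A (a n) p\<bar> \<le> \<bar>step_seq n p\<bar> + \<bar>H p\<bar>"
          using spec [of n] A unfolding approximating_block_def by blast
        have [measurable]: "H \<in> borel_measurable (lebesgue_on unit_square)"
          by (rule borel_imp_lebesgue_on) fact
        have fin: "finite A" using A by (simp add: exhausting_def)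
        \<comment> \<open>The term with \<open>H\<close> covers the cut bump off \<open>B n\<close>,
          the constant covers \<open>B n\<close> itself. Each contributes at most
          \<open>(1 / 2) ^ n\<close>.\<close>
        have "weighted_norm \<mu> (wsum A (a n)) \<le> (\<integral>\<^sup>+ p. ennreal (\<bar>step_seq n p\<bar> * \<mu> p)
            + (ennreal \<bar>H p\<bar> + ennreal ((1 / 2) ^ n)) \<partial>lebesgue_on unit_square)"
          unfolding weighted_norm_def
        proof (rule nn_integral_mono_AE)
          show "AE p in lebesgue_on unit_square. ennreal (\<bar>wsum A (a n) p\<bar> * \<mu> p)
              \<le> ennreal (\<bar>step_seq n p\<bar> * \<mu> p) + (ennreal \<bar>H p\<bar> + ennreal ((1 / 2) ^ n))"
            using \<mu>B [OF n] sq
          proof eventually_elim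
            case (elim p)
            have pos: "0 < \<mu> p" and "\<mu> p \<le> 1" using elim \<mu>_pos \<mu>_le_1 by auto
            have "\<bar>wsum A (a n) p\<bar> * \<mu> p \<le> \<bar>step_seq n p\<bar> * \<mu> p + (\<bar>H p\<bar> + (1 / 2) ^ n)"
            proof (cases "p \<in> B n")
              case True
              have "\<bar>wsum A (a n) p\<bar> * \<mu> p \<le> h n * \<mu> p"
                using pos by (intro mult_right_mono h_sum [OF fin]) auto
              also have "\<dots> \<le> (1 / 2) ^ n" using elim True by simp
              also have "\<dots> \<le> \<bar>step_seq n p\<bar> * \<mu> p + (\<bar>H p\<bar> + (1 / 2) ^ n)"
                using pos by (simp add: add_nonneg_nonneg)
              finally show ?thesis .
            next
              case False
              have "\<bar>wsum A (a n) p\<bar> * \<mu> p \<le> (\<bar>step_seq n p\<bar> + \<bar>H p\<bar>) * \<mu> p"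
                using pos by (intro mult_right_mono le [OF False]) auto
              also have "\<dots> \<le> \<bar>step_seq n p\<bar> * \<mu> p + \<bar>H p\<bar>"
                using \<open>\<mu> p \<le> 1\<close> pos by (simp add: distrib_right mult_left_le)
              also have "\<dots> \<le> \<bar>step_seq n p\<bar> * \<mu> p + (\<bar>H p\<bar> + (1 / 2) ^ n)" by simp
              finally show ?thesis .
            qed
            then have "ennreal (\<bar>wsum A (a n) p\<bar> * \<mu> p)
                \<le> ennreal (\<bar>step_seq n p\<bar> * \<mu> p + (\<bar>H p\<bar> + (1 / 2) ^ n))"
              by (rule ennreal_leI)
            then show ?case using pos by simp
          qed
        qed
        also have "\<dots> = weighted_norm \<mu> (step_seq n)
            + ((\<integral>\<^sup>+ p. ennreal \<bar>H p\<bar> \<partial>lebesgue_on unit_square) + ennreal ((1 / 2) ^ n))"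
        proof -
          have "(\<integral>\<^sup>+ p. ennreal (\<bar>step_seq n p\<bar> * \<mu> p) + (ennreal \<bar>H p\<bar> + ennreal ((1 / 2) ^ n)) \<partial>lebesgue_on unit_square)
              = weighted_norm \<mu> (step_seq n) + (\<integral>\<^sup>+ p. ennreal \<bar>H p\<bar> + ennreal ((1 / 2) ^ n) \<partial>lebesgue_on unit_square)"
            unfolding weighted_norm_def by (rule nn_integral_add) measurable
          also have "(\<integral>\<^sup>+ p. ennreal \<bar>H p\<bar> + ennreal ((1 / 2) ^ n) \<partial>lebesgue_on unit_square)
              = (\<integral>\<^sup>+ p. ennreal \<bar>H p\<bar> \<partial>lebesgue_on unit_square) + (\<integral>\<^sup>+ p. ennreal ((1 / 2) ^ n) \<partial>lebesgue_on unit_square)"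
            by (rule nn_integral_add) measurable
          finally show ?thesis unfolding total .
        qed
        also have "\<dots> \<le> weighted_norm \<mu> (step_seq n) + (ennreal ((1 / 2) ^ n) + ennreal ((1 / 2) ^ n))"
          by (intro add_left_mono add_right_mono H)
        also have "ennreal ((1 / 2) ^ n) + ennreal ((1 / 2) ^ n) = ennreal (2 * (1 / 2) ^ n)"
          by (subst ennreal_plus [symmetric]) auto
        finally show ?thesis .
      qed
    qed
    show "\<exists>\<mu>. \<mu> \<in> borel_measurable (lebesgue_on unit_square) \<and>
         (\<forall>p \<in> unit_square. 0 < \<mu> p \<and> \<mu> p \<le> 1) \<and>
         measure lebesgue {p \<in> unit_square. \<mu> p \<noteq> 1} < \<epsilon> \<and>
         universal_subseries \<mu> (glue a)"
      using \<mu>_measurable \<mu>_pos \<mu>_le_1 small universal by blast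
  qed
qed

end
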